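(* Let $d\ge2$ be an integer and $(c_j)_{j\ge0}$ an integer sequence taking only finitely many values; put $f(z)=\sum_{j\ge0}c_jz^j$. Suppose there exist polynomials $A(z),B(z),C(z),D(z)\in\mathbb{Z}[z]$, with $B,D\neq0$, such that $$f(z)=\frac{A(z)}{B(z)}+\frac{C(z)}{D(z)}f(z^d).$$ Let $b\ge2$ be an integer such that $C(1/b^{d^m})\neq0$ for all integers $m\ge0$. If there exists an increasing sequence of positive integers $(n_i)_{i\ge0}$ such that $H_{n_i}(f)\neq0$ for all $i\ge0$ and $\lim_{i\to\infty}n_{i+1}/n_i=1$, then $f(1/b)$ is transcendental and its irrationality exponent is equal to $2$.
   Context: For a power series $f(z)=\sum_{j\ge0}c_jz^j$, its Hankel determinants are $H_0(f)=1$ and, for $n\ge1$, $H_n(f)=\det(c_{i+j})_{0\le i,j\le n-1}$. The irrationality exponent $\mu(\xi)$ of an irrational real number $\xi$ is the supremum of the real numbers $\mu$ such that $|\xi-p/q|<q^{-\mu}$ has infinitely many solutions in rational numbers $p/q$. *)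

theory Defs
  imports Complex_Main "HOL-Computational_Algebra.Polynomial" "HOL-Library.Extended_Real"
    "Jordan_Normal_Form.Determinant"
begin

text \<open>Hankel determinant H_n(f) = det (c_{i+j})_{0<=i,j<=n-1}; for n = 0 this is the
  determinant of the empty matrix, i.e. 1.\<close>
definition hankel_det :: "(nat \<Rightarrow> int) \<Rightarrow> nat \<Rightarrow> int" where
  "hankel_det c n = det (mat n n (\<lambda>(i, j). c (i + j)))"

definition irrationality_exponent :: "real \<Rightarrow> ereal" where
  "irrationality_exponent \<xi> =
     Sup (ereal ` {\<mu>::real. infinite {r::rat. \<bar>\<xi> - of_rat r\<bar> <
                                    real_of_int (snd (quotient_of r)) powr (- \<mu>)}})"

definition ipoly :: "int poly \<Rightarrow> real \<Rightarrow> real" where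
  "ipoly p x = poly (map_poly real_of_int p) x"

end

theory Submission
  imports "HOL-Analysis.Kronecker_Approximation_Theorem" "HOL-Analysis.FPS_Convergence" Defs
begin

text \<open>Put \<open>t = b\<^bsup>d^m\<^esup>\<close>. Iterating the functional equation expresses \<open>f(1/t)\<close> as an affine function
  of \<open>\<xi> = f(1/b)\<close>, with integer coefficients of size at most \<open>t\<^sup>K\<close> for a fixed \<open>K\<close>.

  Irrationality exponent: let \<open>n < n'\<close> be consecutive terms of the given sequence. A Pade form
  \<open>Q f - P\<close> of degree \<open>n\<close> vanishes at \<open>0\<close> to an order between \<open>2 n\<close> and \<open>n + n' - 1\<close>, the upper bound
  because the Hankel determinant of order \<open>n'\<close> is nonzero. At \<open>1/t\<close> it yields an integer linear
  form in \<open>1, \<xi>\<close> with coefficients about \<open>t\<^sup>n\<close> and value between about \<open>t\<^bsup>-n'\<^esup>\<close> and \<open>t\<^bsup>-n\<^esup>\<close>. For \<open>n\<close> in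
  a finite range and all \<open>m\<close> these scales are so dense that every exponent above \<open>2\<close> is excluded.

  Transcendence: if \<open>f\<close> were algebraic over the polynomials, then \<open>Q f\<close> would be integral for some
  polynomial \<open>Q\<close>, hence bounded on the unit disc, and by Parseval its integer coefficients would
  eventually vanish, contradicting the nonvanishing of the Hankel determinants. So Mahler's method
  applies: an auxiliary form \<open>\<Sum>P\<^sub>j f\<^sup>j\<close> of degree \<open>N\<close> that vanishes to order \<open>N\<^sup>2\<close> is nonzero but
  too small at \<open>1/t\<close> for an algebraic \<open>\<xi>\<close>.\<close>

section \<open>Integer linear systems and a lower bound for polynomials at algebraic numbers\<close>

text \<open>The obstacle is that \<open>B\<close> or \<open>D\<close> may vanish at
  \<open>1/t\<close> for small \<open>m\<close>, where the functional equation says nothing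
  directly. So \<open>f(1/t)\<close> is first proved irrational for all large \<open>m\<close>. At
  the exceptional points a relation with rational coefficients follows by continuity; such relations
  carry irrationality down to \<open>m = 0\<close>, and irrationality in turn excludes a zero
  coefficient of \<open>f(1/t)\<close>. Then \<open>f(1/b)\<close> and \<open>f(1/t)\<close> are
  affine images of each other over the rationals, and the results for large \<open>m\<close> apply
  to \<open>f(1/b)\<close>. \<open>K\<close> stays fixed because each step raises \<open>t\<close>
  to the power \<open>d \<ge> 2\<close>, which outgrows the fixed power of \<open>t\<close> by which
  the step enlarges the coefficients. Against large \<open>n\<close> the loss \<open>K\<close> is
  negligible, and the ratio hypothesis makes \<open>n\<close> and \<open>n'\<close> comparable.
  Passing from \<open>m\<close> to \<open>m + 1\<close> multiplies every scale by \<open>d\<close>,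
  so a finite range of \<open>n\<close> covers all scales. For transcendence, the exponent in the
  Liouville bound depends on \<open>\<xi>\<close> only, so \<open>N\<close> may be chosen after it.
  All auxiliary polynomials are fixed before \<open>m\<close> grows; their coefficients enter only
  through constants.\<close>

lemma det_eq_0_iff_kernel:
  fixes a :: "nat \<Rightarrow> nat \<Rightarrow> int"
  shows "det (mat n n (\<lambda>(i, j). a i j)) = 0 \<longleftrightarrow>
    (\<exists>v. (\<exists>j<n. v j \<noteq> 0) \<and> (\<forall>i<n. (\<Sum>j<n. a i j * v j) = 0))"
    (is "?l \<longleftrightarrow> ?r")
proof -
  let ?M = "mat n n (\<lambda>(i, j). a i j)"
  have M: "?M \<in> carrier_mat n n" by simp
  have ker: "?l \<longleftrightarrow> (\<exists>v. v \<in> carrier_vec n \<and> v \<noteq> 0\<^sub>v n \<and> ?M *\<^sub>v v = 0\<^sub>v n)"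
    by (rule det_0_iff_vec_prod_zero[OF M])
  show ?thesis
  proof
    assume ?l
    then obtain v where v: "v \<in> carrier_vec n" "v \<noteq> 0\<^sub>v n" "?M *\<^sub>v v = 0\<^sub>v n"
      using ker by blast
    have "\<exists>j<n. vec_index v j \<noteq> 0"
    proof (rule ccontr)
      assume "\<not> ?thesis"
      hence "v = 0\<^sub>v n" using v(1) by (intro eq_vecI) auto
      thus False using v(2) by simp
    qed
    moreover have "(\<Sum>j<n. a i j * vec_index v j) = 0" if "i < n" for i
    proof -
      have "vec_index (?M *\<^sub>v v) i = 0" using v that by simp
      thus ?thesis using that v(1) by (simp add: scalar_prod_def atLeast0LessThan)
    qed
    ultimately show ?r by blast
  next
    assume ?r
    then obtain v where v: "\<exists>j<n. v j \<noteq> 0" "\<And>i. i < n \<Longrightarrow> (\<Sum>j<n. a i j * v j) = 0"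
      by blast
    have "vec n v \<noteq> 0\<^sub>v n" using v(1) by (metis index_vec index_zero_vec(1))
    moreover have "?M *\<^sub>v vec n v = 0\<^sub>v n"
      using v(2) by (intro eq_vecI) (simp_all add: scalar_prod_def atLeast0LessThan)
    ultimately show ?l using ker vec_carrier by blast
  qed
qed

lemma det_transposed:
  "det (mat n n (\<lambda>(i, j). a j i)) = det (mat n n (\<lambda>(i, j). a i j) :: int mat)"
proof -
  have "mat n n (\<lambda>(i, j). a j i) = transpose_mat (mat n n (\<lambda>(i, j). a i j))"
    by (intro eq_matI) auto
  thus ?thesis by (simp add: det_transpose[of _ n])
qed

text \<open>Padding with zero rows makes the system square with determinant zero, and the kernel
  criterion over the integers yields an integral solution.\<close>

lemma underdetermined_int_system:
  fixes a :: "nat \<Rightarrow> nat \<Rightarrow> int"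
  assumes "k < n"
  obtains v :: "nat \<Rightarrow> int" where "\<exists>j<n. v j \<noteq> 0" "\<And>i. i < k \<Longrightarrow> (\<Sum>j<n. a i j * v j) = 0"
proof -
  define a' where "a' = (\<lambda>i j. if i < k then a i j else 0)"
  have "det (mat n n (\<lambda>(i, j). a' j i)) = 0"
    unfolding det_eq_0_iff_kernel[of n "\<lambda>i j. a' j i"]
  \<comment> \<open>Row \<open>n - 1 \<ge> k\<close> of \<open>a'\<close> is zero, so the last unit
    vector lies in the kernel of the transpose.\<close>
  proof (intro exI[of _ "\<lambda>j. if j = n - 1 then 1 else 0"] conjI allI impI)
    show "\<exists>j<n. (if j = n - 1 then 1 else 0 :: int) \<noteq> 0"
      using assms by (intro exI[of _ "n - 1"]) auto
    show "(\<Sum>j<n. a' j i * (if j = n - 1 then 1 else 0)) = 0" for i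
      using assms by (intro sum.neutral) (auto simp: a'_def)
  qed
  hence "det (mat n n (\<lambda>(i, j). a' i j)) = 0" by (simp only: det_transposed[of n a'])
  then obtain v where v: "\<exists>j<n. v j \<noteq> 0" "\<forall>i<n. (\<Sum>j<n. a' i j * v j) = 0"
    unfolding det_eq_0_iff_kernel by blast
  have "(\<Sum>j<n. a i j * v j) = 0" if "i < k" for i
    using v(2)[rule_format, of i] that assms by (simp add: a'_def)
  thus ?thesis using v(1) that by blast
qed

lemma abs_det_le:
  fixes M :: "int mat"
  assumes "M \<in> carrier_mat n n" and "\<And>i j. i < n \<Longrightarrow> j < n \<Longrightarrow> \<bar>real_of_int (M $$ (i, j))\<bar> \<le> K"
  shows "\<bar>real_of_int (det M)\<bar> \<le> fact n * K ^ n"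
proof -
  let ?P = "{p. p permutes {0..<n}}"
  have "\<bar>real_of_int (det M)\<bar>
      = \<bar>\<Sum>p\<in>?P. real_of_int (signof p) * (\<Prod>i = 0..<n. real_of_int (M $$ (i, p i)))\<bar>"
    by (simp add: det_def'[OF assms(1)])
  also have "\<dots> \<le> (\<Sum>p\<in>?P. \<bar>real_of_int (signof p) * (\<Prod>i = 0..<n. real_of_int (M $$ (i, p i)))\<bar>)"
    by (rule sum_abs)
  also have "\<dots> \<le> (\<Sum>p\<in>?P. K ^ n)"
  proof (rule sum_mono)
    fix p assume p: "p \<in> ?P"
    have "\<bar>\<Prod>i = 0..<n. real_of_int (M $$ (i, p i))\<bar> = (\<Prod>i = 0..<n. \<bar>real_of_int (M $$ (i, p i))\<bar>)"
      by (rule abs_prod)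
    also have "\<dots> \<le> (\<Prod>i = 0..<n. K)"
      using p assms(2) permutes_in_image[of p "{0..<n}"] by (intro prod_mono) auto
    finally show "\<bar>real_of_int (signof p) * (\<Prod>i = 0..<n. real_of_int (M $$ (i, p i)))\<bar> \<le> K ^ n"
      by (simp add: abs_mult sign_def)
  qed
  also have "\<dots> = fact n * K ^ n" using card_permutations[of "{0..<n}" n] by simp
  finally show ?thesis .
qed

text \<open>\<open>s\<close> is the degree of \<open>\<xi>\<close>: the least length of an integer
  relation. A nontrivial relation below \<open>s\<close>, cut at its last nonzero coefficient, would
  be a shorter one.\<close>

lemma minimal_integer_relation:
  fixes \<xi> :: real
  assumes "algebraic \<xi>"
  obtains s :: nat and v :: "nat \<Rightarrow> int" where "s > 0" "v s \<noteq> 0" "(\<Sum>j\<le>s. of_int (v j) * \<xi> ^ j) = 0"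
    "\<And>w :: nat \<Rightarrow> int. (\<Sum>j<s. of_int (w j) * \<xi> ^ j) = 0 \<Longrightarrow> \<forall>j<s. w j = 0"
proof -
  define P where "P = (\<lambda>s. \<exists>v :: nat \<Rightarrow> int. v s \<noteq> 0 \<and> (\<Sum>j\<le>s. of_int (v j) * \<xi> ^ j) = 0)"
  obtain p where p: "poly (map_poly of_int p) \<xi> = 0" "p \<noteq> 0"
    using algebraicE'[OF assms] by blast
  have "P (degree p)" unfolding P_def
    using p by (intro exI[of _ "coeff p"]) (auto simp: poly_altdef coeff_map_poly degree_map_poly)
  define s where "s = (LEAST s. P s)"
  have "P s" unfolding s_def by (rule LeastI) fact
  then obtain v where v: "v s \<noteq> 0" "(\<Sum>j\<le>s. of_int (v j) * \<xi> ^ j) = 0" by (auto simp: P_def)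
  have "s > 0" using v by (cases s) auto
  moreover have "\<forall>j<s. w j = 0" if w: "(\<Sum>j<s. of_int (w j) * \<xi> ^ j) = 0" for w :: "nat \<Rightarrow> int"
  proof (rule ccontr)
    assume "\<not> ?thesis"
    hence ne: "{j. j < s \<and> w j \<noteq> 0} \<noteq> {}" by blast
    define t where "t = Max {j. j < s \<and> w j \<noteq> 0}"
    have t: "t < s" "w t \<noteq> 0" using Max_in[OF _ ne] by (auto simp: t_def)
    have above: "w j = 0" if "t < j" "j < s" for j
    proof (rule ccontr)
      assume "w j \<noteq> 0"
      hence "j \<le> t" unfolding t_def using that by (intro Max_ge) auto
      thus False using that by simp
    qed
    have "(\<Sum>j\<le>t. of_int (w j) * \<xi> ^ j) = (\<Sum>j<s. of_int (w j) * \<xi> ^ j)"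
      using t above by (intro sum.mono_neutral_left) auto
    hence "P t" unfolding P_def using t w by (intro exI[of _ w]) simp
    thus False using t(1) not_less_Least[of t P] by (simp add: s_def)
  qed
  ultimately show ?thesis using that v by blast
qed

text \<open>Multiplication by \<open>\<xi>\<close> shifts the coefficients, and the relation
  \<open>v\<close> reduces the new term in \<open>\<xi> ^ s\<close>. Each reduction costs a factor
  \<open>v s\<close> in the denominator, as \<open>\<xi>\<close> need not be an algebraic
  integer.\<close>

lemma powers_as_low_combinations:
  fixes \<xi> :: real and v :: "nat \<Rightarrow> int"
  assumes s: "s > 0" and v: "v s \<noteq> 0" "(\<Sum>j\<le>s. of_int (v j) * \<xi> ^ j) = 0"
  shows "\<exists>\<Delta>::int. \<Delta> \<noteq> 0 \<and> (\<exists>e :: nat \<Rightarrow> int. of_int \<Delta> * \<xi> ^ k = (\<Sum>j<s. of_int (e j) * \<xi> ^ j))"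
proof (induction k)
  case 0
  have "(\<Sum>j<s. of_int (if j = 0 then 1 else 0) * \<xi> ^ j) = (\<Sum>j<s. if j = 0 then 1 else 0)"
    by (intro sum.cong) auto
  also have "\<dots> = 1" using s by simp
  finally show ?case by (intro exI[of _ 1] conjI exI[of _ "\<lambda>j. if j = 0 then 1 else 0"]) auto
next
  case (Suc k)
  then obtain \<Delta> e where IH: "\<Delta> \<noteq> 0" "of_int \<Delta> * \<xi> ^ k = (\<Sum>j<s. of_int (e j) * \<xi> ^ j)" by blast
  \<comment> \<open>The shifted coefficients, scaled by \<open>v s\<close>, minus the top
    coefficient times the relation.\<close>
  define e' where "e' = (\<lambda>j. v s * (if j = 0 then 0 else e (j - 1)) - e (s - 1) * v j)"
  obtain t where t: "s = Suc t" using s by (cases s) auto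
  have top: "of_int (v s) * \<xi> ^ s = - (\<Sum>j<s. of_int (v j) * \<xi> ^ j)"
    using v(2) by (simp add: lessThan_Suc_atMost[symmetric])
  have shift: "(\<Sum>j<s. of_int (if j = 0 then 0 else e (j - 1)) * \<xi> ^ j) = (\<Sum>j<t. of_int (e j) * \<xi> ^ Suc j)"
    unfolding t sum.lessThan_Suc_shift by simp
  have "of_int (\<Delta> * v s) * \<xi> ^ Suc k = of_int (v s) * \<xi> * (of_int \<Delta> * \<xi> ^ k)" by simp
  also have "\<dots> = of_int (v s) * (\<Sum>j<t. of_int (e j) * \<xi> ^ Suc j) + of_int (e t) * (of_int (v s) * \<xi> ^ s)"
    unfolding IH(2) t by (simp add: sum_distrib_left algebra_simps)
  also have "\<dots> = (\<Sum>j<s. of_int (e' j) * \<xi> ^ j)"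
    unfolding top shift[symmetric] e'_def using t
    by (simp add: sum_distrib_left sum_subtractf[symmetric] left_diff_distrib right_diff_distrib mult_ac
        del: sum.lessThan_Suc)
  finally show ?case using IH(1) v(1) by (intro exI[of _ "\<Delta> * v s"]) auto
qed

lemma powers_common_denominator:
  fixes \<xi> :: real and v :: "nat \<Rightarrow> int"
  assumes s: "s > 0" and v: "v s \<noteq> 0" "(\<Sum>j\<le>s. of_int (v j) * \<xi> ^ j) = 0"
  shows "\<exists>\<Delta>::int. \<Delta> \<noteq> 0 \<and> (\<forall>k<L. \<exists>e :: nat \<Rightarrow> int. of_int \<Delta> * \<xi> ^ k = (\<Sum>j<s. of_int (e j) * \<xi> ^ j))"
proof (induction L)
  case (Suc L)
  then obtain \<Delta> where \<Delta>: "\<Delta> \<noteq> 0" "\<And>k. k < L \<Longrightarrow> \<exists>e :: nat \<Rightarrow> int. of_int \<Delta> * \<xi> ^ k = (\<Sum>j<s. of_int (e j) * \<xi> ^ j)"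
    by blast
  obtain \<Delta>' where \<Delta>': "\<Delta>' \<noteq> 0" "\<exists>e :: nat \<Rightarrow> int. of_int \<Delta>' * \<xi> ^ L = (\<Sum>j<s. of_int (e j) * \<xi> ^ j)"
    using powers_as_low_combinations[OF assms] by blast
  have scale: "\<exists>e :: nat \<Rightarrow> int. of_int (x * y) * z = (\<Sum>j<s. of_int (e j) * \<xi> ^ j)"
    if ex: "\<exists>e :: nat \<Rightarrow> int. of_int y * z = (\<Sum>j<s. of_int (e j) * \<xi> ^ j)" for x y :: int and z :: real
  proof -
    obtain e :: "nat \<Rightarrow> int" where "of_int y * z = (\<Sum>j<s. of_int (e j) * \<xi> ^ j)" using ex by blast
    hence "of_int (x * y) * z = (\<Sum>j<s. of_int (x * e j) * \<xi> ^ j)"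
      by (simp add: mult.assoc sum_distrib_left)
    thus ?thesis by (rule exI[of _ "\<lambda>j. x * e j"])
  qed
  show ?case
  proof (intro exI[of _ "\<Delta>' * \<Delta>"] conjI allI impI)
    show "\<Delta>' * \<Delta> \<noteq> 0" using \<Delta> \<Delta>' by simp
    fix k assume "k < Suc L"
    thus "\<exists>e :: nat \<Rightarrow> int. of_int (\<Delta>' * \<Delta>) * \<xi> ^ k = (\<Sum>j<s. of_int (e j) * \<xi> ^ j)"
      using scale[OF \<Delta>(2)] scale[OF \<Delta>'(2), of \<Delta>] by (cases "k = L") (auto simp: mult.commute)
  qed
qed (auto intro: exI[of _ 1])

text \<open>Multiplication by \<open>\<rho> = \<Sum>r\<^sub>k \<xi>\<^sup>k\<close> acts on the basis \<open>1, \<xi>, \<dots>, \<xi>\<^bsup>s-1\<^esup>\<close> of \<open>\<rat>(\<xi>)\<close> by an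
  integer matrix (up to a fixed denominator); its determinant is a nonzero integer, and Cramer's
  rule bounds it by a multiple of \<open>\<rho>\<close>.\<close>
lemma algebraic_liouville:
  fixes \<xi> :: real
  assumes "algebraic \<xi>"
  obtains \<kappa> :: nat where "\<And>N. \<exists>c>0. \<forall>(r :: nat \<Rightarrow> int) H. H \<ge> 1 \<longrightarrow> (\<forall>k\<le>N. \<bar>real_of_int (r k)\<bar> \<le> H) \<longrightarrow>
      (\<Sum>k\<le>N. of_int (r k) * \<xi> ^ k) \<noteq> 0 \<longrightarrow> c / H ^ \<kappa> \<le> \<bar>\<Sum>k\<le>N. of_int (r k) * \<xi> ^ k\<bar>"
proof -
  obtain s v where s: "s > 0" and v: "v s \<noteq> 0" "(\<Sum>j\<le>s. of_int (v j) * \<xi> ^ j) = 0"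
    and indep: "\<And>w :: nat \<Rightarrow> int. (\<Sum>j<s. of_int (w j) * \<xi> ^ j) = 0 \<Longrightarrow> \<forall>j<s. w j = 0"
    using minimal_integer_relation[OF assms] by metis
  show ?thesis
  \<comment> \<open>The entries of the adjugate are minors of order \<open>s - 1\<close>, whence the
    exponent, which does not depend on \<open>N\<close>.\<close>
  proof (rule that[of "s - 1"])
    fix N :: nat
    \<comment> \<open>The products \<open>\<xi> ^ (k + i)\<close> with \<open>k \<le> N\<close> and
      \<open>i < s\<close> reach the power \<open>N + s - 1\<close>.\<close>
    obtain \<Delta> :: int where \<Delta>: "\<Delta> \<noteq> 0"
      "\<forall>k<N + s. \<exists>e :: nat \<Rightarrow> int. of_int \<Delta> * \<xi> ^ k = (\<Sum>j<s. of_int (e j) * \<xi> ^ j)"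
      using powers_common_denominator[where v = v and s = s and \<xi> = \<xi> and L = "N + s"] s v by blast
    then obtain e :: "nat \<Rightarrow> nat \<Rightarrow> int" where
      e: "\<And>k. k < N + s \<Longrightarrow> of_int \<Delta> * \<xi> ^ k = (\<Sum>j<s. of_int (e k j) * \<xi> ^ j)"
      by metis
    define E where "E = (\<Sum>k<N + s. \<Sum>j<s. \<bar>real_of_int (e k j)\<bar>) + 1"
    have eE: "\<bar>real_of_int (e k j)\<bar> \<le> E" if "k < N + s" "j < s" for k j
    proof -
      have "\<bar>real_of_int (e k j)\<bar> \<le> (\<Sum>j<s. \<bar>real_of_int (e k j)\<bar>)"
        using that by (intro member_le_sum[of j "{..<s}" "\<lambda>j. \<bar>real_of_int (e k j)\<bar>"]) auto
      also have "\<dots> \<le> (\<Sum>k<N + s. \<Sum>j<s. \<bar>real_of_int (e k j)\<bar>)"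
        using that by (intro member_le_sum[of k "{..<N+s}" "\<lambda>k. \<Sum>j<s. \<bar>real_of_int (e k j)\<bar>"])
          (auto intro: sum_nonneg)
      finally show ?thesis by (simp add: E_def)
    qed
    have "E > 0" unfolding E_def by (intro add_nonneg_pos sum_nonneg) auto
    define c0 where "c0 = fact (s - 1) * (real (N + 1) * E) ^ (s - 1) * \<bar>real_of_int \<Delta>\<bar> * (\<Sum>i<s. \<bar>\<xi>\<bar> ^ i)"
    have "(\<Sum>i<s. \<bar>\<xi>\<bar> ^ i) > 0"
      using s by (intro sum_pos2[of _ 0]) auto
    hence "c0 > 0" using \<Delta>(1) \<open>E > 0\<close> by (simp add: c0_def)
    show "\<exists>c>0. \<forall>(r :: nat \<Rightarrow> int) H. H \<ge> 1 \<longrightarrow> (\<forall>k\<le>N. \<bar>real_of_int (r k)\<bar> \<le> H) \<longrightarrow>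
      (\<Sum>k\<le>N. of_int (r k) * \<xi> ^ k) \<noteq> 0 \<longrightarrow> c / H ^ (s - 1) \<le> \<bar>\<Sum>k\<le>N. of_int (r k) * \<xi> ^ k\<bar>"
    proof (intro exI[of _ "1 / c0"] conjI allI impI)
      show "1 / c0 > 0" using \<open>c0 > 0\<close> by simp
      fix r :: "nat \<Rightarrow> int" and H :: real
      assume H: "H \<ge> 1" "\<forall>k\<le>N. \<bar>real_of_int (r k)\<bar> \<le> H"
        and nz: "(\<Sum>k\<le>N. of_int (r k) * \<xi> ^ k) \<noteq> 0"
      define \<rho> where "\<rho> = (\<Sum>k\<le>N. of_int (r k) * \<xi> ^ k)"
      define M where "M = (\<lambda>i j. \<Sum>k\<le>N. r k * e (k + i) j)"
      define K where "K = real (N + 1) * E * H"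
      have MK: "\<bar>real_of_int (M i j)\<bar> \<le> K" if "i < s" "j < s" for i j
      proof -
        have "\<bar>real_of_int (M i j)\<bar> \<le> (\<Sum>k\<le>N. \<bar>real_of_int (r k) * real_of_int (e (k + i) j)\<bar>)"
          unfolding M_def of_int_sum of_int_mult by (rule sum_abs)
        also have "\<dots> \<le> (\<Sum>k\<le>N. H * E)"
          unfolding abs_mult using H that by (intro sum_mono mult_mono eE) auto
        finally show ?thesis by (simp add: K_def algebra_simps)
      qed
      have row: "of_int \<Delta> * \<rho> * \<xi> ^ i = (\<Sum>j<s. of_int (M i j) * \<xi> ^ j)" if "i < s" for i
      proof -
        have "of_int \<Delta> * \<rho> * \<xi> ^ i = (\<Sum>k\<le>N. of_int (r k) * (of_int \<Delta> * \<xi> ^ (k + i)))"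
          unfolding \<rho>_def by (simp add: sum_distrib_left sum_distrib_right power_add mult_ac)
        also have "\<dots> = (\<Sum>k\<le>N. \<Sum>j<s. of_int (r k) * of_int (e (k + i) j) * \<xi> ^ j)"
          using that by (intro sum.cong) (auto simp: e sum_distrib_left mult.assoc)
        also have "\<dots> = (\<Sum>j<s. \<Sum>k\<le>N. of_int (r k) * of_int (e (k + i) j) * \<xi> ^ j)"
          by (rule sum.swap)
        also have "\<dots> = (\<Sum>j<s. of_int (M i j) * \<xi> ^ j)"
          by (simp add: M_def sum_distrib_right)
        finally show ?thesis .
      qed
      let ?M = "mat s s (\<lambda>(i, j). M i j)"
      have Mc: "?M \<in> carrier_mat s s" by simp
      \<comment> \<open>A left kernel vector \<open>w\<close> would make
        \<open>\<Delta> \<rho>\<close> times a nontrivial combination of the basis vanish, although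
        \<open>\<Delta> \<rho> \<noteq> 0\<close>.\<close>
      have "det ?M \<noteq> 0"
      proof
        assume "det ?M = 0"
        hence "det (mat s s (\<lambda>(i, j). M j i)) = 0" by (simp only: det_transposed[of s M])
        then obtain w where w: "\<exists>j<s. w j \<noteq> 0" "\<And>j. j < s \<Longrightarrow> (\<Sum>i<s. M i j * w i) = 0"
          unfolding det_eq_0_iff_kernel[of s "\<lambda>i j. M j i"] by blast
        have "of_int \<Delta> * \<rho> * (\<Sum>i<s. of_int (w i) * \<xi> ^ i) = (\<Sum>i<s. of_int (w i) * (of_int \<Delta> * \<rho> * \<xi> ^ i))"
          by (simp add: sum_distrib_left mult_ac)
        also have "\<dots> = (\<Sum>i<s. \<Sum>j<s. of_int (M i j * w i) * \<xi> ^ j)"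
          by (intro sum.cong refl, simp only: row lessThan_iff sum_distrib_left) (simp add: mult_ac)
        also have "\<dots> = (\<Sum>j<s. of_int (\<Sum>i<s. M i j * w i) * \<xi> ^ j)"
          by (subst sum.swap) (simp add: sum_distrib_right)
        also have "\<dots> = 0" by (simp add: w del: of_int_sum)
        finally have "(\<Sum>i<s. of_int (w i) * \<xi> ^ i) = 0" using \<Delta>(1) nz by (simp add: \<rho>_def)
        thus False using indep[of w] w(1) by blast
      qed
      \<comment> \<open>Row 0 of the adjugate combines the rows of \<open>M\<close> into
        \<open>det M\<close> times the basis element 1. The same combination of the numbers
        \<open>\<Delta> \<rho> \<xi> ^ i\<close> is therefore the integer
        \<open>det M\<close>.\<close>
      define u where "u = (\<lambda>i. adj_mat ?M $$ (0, i))"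
      have uK: "\<bar>real_of_int (u i)\<bar> \<le> fact (s - 1) * K ^ (s - 1)" if "i < s" for i
      proof -
        have "\<bar>real_of_int (det (mat_delete ?M i 0))\<bar> \<le> fact (s - 1) * K ^ (s - 1)"
        proof (rule abs_det_le)
          show "mat_delete ?M i 0 \<in> carrier_mat (s - 1) (s - 1)" by (simp add: mat_delete_def)
          show "\<bar>real_of_int (mat_delete ?M i 0 $$ (i', j'))\<bar> \<le> K" if "i' < s - 1" "j' < s - 1" for i' j'
            using that by (auto simp: mat_delete_def intro!: MK)
        qed
        thus ?thesis using that s by (simp add: u_def adj_mat_def cofactor_def abs_mult)
      qed
      have col: "(\<Sum>i<s. u i * M i j) = (if j = 0 then det ?M else 0)" if "j < s" for j
      proof -
        have "(adj_mat ?M * ?M) $$ (0, j) = (det ?M \<cdot>\<^sub>m 1\<^sub>m s) $$ (0, j)"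
          by (simp only: adj_mat(3)[OF Mc])
        moreover have "(adj_mat ?M * ?M) $$ (0, j) = (\<Sum>i<s. u i * M i j)"
          using that s adj_mat(1)[OF Mc]
          by (simp add: times_mat_def scalar_prod_def u_def atLeast0LessThan Matrix.row_def Matrix.col_def)
        ultimately show ?thesis using that s by auto
      qed
      have "of_int (det ?M) = (\<Sum>j<s. if j = 0 then of_int (det ?M) else (0::real))"
        using s by simp
      also have "\<dots> = (\<Sum>j<s. of_int (\<Sum>i<s. u i * M i j) * \<xi> ^ j)"
        by (intro sum.cong) (auto simp: col simp del: of_int_sum)
      also have "\<dots> = (\<Sum>j<s. \<Sum>i<s. of_int (u i) * (of_int (M i j) * \<xi> ^ j))"
        by (simp add: sum_distrib_left sum_distrib_right mult_ac)
      also have "\<dots> = (\<Sum>i<s. of_int (u i) * (of_int \<Delta> * \<rho> * \<xi> ^ i))"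
        by (subst sum.swap) (simp add: row sum_distrib_left)
      finally have eq: "real_of_int (det ?M) = (\<Sum>i<s. of_int (u i) * (of_int \<Delta> * \<rho> * \<xi> ^ i))" .
      have "1 \<le> \<bar>real_of_int (det ?M)\<bar>" using \<open>det ?M \<noteq> 0\<close> by linarith
      also have "\<dots> \<le> (\<Sum>i<s. \<bar>of_int (u i) * (of_int \<Delta> * \<rho> * \<xi> ^ i)\<bar>)"
        unfolding eq by (rule sum_abs)
      also have "\<dots> \<le> (\<Sum>i<s. fact (s - 1) * K ^ (s - 1) * (\<bar>of_int \<Delta>\<bar> * \<bar>\<rho>\<bar> * \<bar>\<xi>\<bar> ^ i))"
        unfolding abs_mult power_abs using uK by (intro sum_mono mult_right_mono) auto
      also have "\<dots> = c0 * H ^ (s - 1) * \<bar>\<rho>\<bar>"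
        by (simp add: c0_def K_def sum_distrib_left sum_distrib_right power_mult_distrib mult_ac)
      finally have "1 \<le> c0 * H ^ (s - 1) * \<bar>\<rho>\<bar>" .
      thus "1 / c0 / H ^ (s - 1) \<le> \<bar>\<Sum>k\<le>N. of_int (r k) * \<xi> ^ k\<bar>"
        using \<open>c0 > 0\<close> H(1) unfolding \<rho>_def[symmetric] by (simp add: field_simps)
    qed
  qed
qed

section \<open>Irrationality exponents\<close>

lemma of_rat_quotient_of:
  "of_rat r = real_of_int (fst (quotient_of r)) / real_of_int (snd (quotient_of r))"
  by (metis Fract_quotient_of of_rat_rat quotient_of_denom_pos' less_irrefl)

lemma quotient_of_Fract_approx_set:
  assumes "(h, k) \<in> approx_set \<xi>"
  shows "quotient_of (Rat.Fract h k) = (h, k)"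
proof -
  have "k > 0" "coprime h k" using assms unfolding approx_set_def by blast+
  thus ?thesis by (simp add: quotient_of_Fract normalize_stable)
qed

text \<open>Dirichlet's theorem gives infinitely many coprime pairs in
  \<open>approx_set \<xi>\<close>; being reduced, they yield distinct rationals with exactly these
  denominators.\<close>

lemma irrationality_exponent_ge_2:
  assumes "\<xi> \<notin> \<rat>"
  shows "irrationality_exponent \<xi> \<ge> 2"
proof -
  have "infinite (approx_set \<xi>)" using assms rational_iff_finite_approx_set by blast
  moreover have "inj_on (\<lambda>(h, k). Rat.Fract h k) (approx_set \<xi>)"
  proof (rule inj_onI, clarify)
    fix h k h' k'
    assume a: "(h, k) \<in> approx_set \<xi>" "(h', k') \<in> approx_set \<xi>" and eq: "Rat.Fract h k = Rat.Fract h' k'"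
    have "quotient_of (Rat.Fract h k) = (h, k)" "quotient_of (Rat.Fract h' k') = (h', k')"
      using a quotient_of_Fract_approx_set by blast+
    thus "h = h' \<and> k = k'" using eq by (metis Pair_inject)
  qed
  ultimately have "infinite ((\<lambda>(h, k). Rat.Fract h k) ` approx_set \<xi>)" using finite_image_iff by blast
  moreover have "(\<lambda>(h, k). Rat.Fract h k) ` approx_set \<xi> \<subseteq>
      {r::rat. \<bar>\<xi> - of_rat r\<bar> < real_of_int (snd (quotient_of r)) powr (- 2)}"
  proof clarify
    fix h k assume a: "(h, k) \<in> approx_set \<xi>"
    have "quotient_of (Rat.Fract h k) = (h, k)"
      using a by (rule quotient_of_Fract_approx_set)
    moreover have k: "k > 0" and near: "\<bar>\<xi> - of_int h / of_int k\<bar> < 1 / (of_int k)\<^sup>2"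
      using a unfolding approx_set_def by auto
    moreover have "of_rat (Rat.Fract h k) = real_of_int h / real_of_int k"
      using k by (simp add: of_rat_rat)
    moreover have "real_of_int k powr (- 2) = 1 / (of_int k)\<^sup>2"
      using k by (simp add: powr_minus inverse_eq_divide powr_numeral)
    ultimately show "\<bar>\<xi> - of_rat (Rat.Fract h k)\<bar> < real_of_int (snd (quotient_of (Rat.Fract h k))) powr (- 2)"
      by (simp only: snd_conv)
  qed
  ultimately have "infinite {r::rat. \<bar>\<xi> - of_rat r\<bar> < real_of_int (snd (quotient_of r)) powr (- 2)}"
    using finite_subset by blast
  thus ?thesis unfolding irrationality_exponent_def
    by (intro Sup_upper image_eqI[where x = 2]) auto
qed

text \<open>Infinitely many good approximations must therefore have unbounded denominators.\<close>

lemma finite_rats_near: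
  fixes \<xi> :: real
  shows "finite {r::rat. snd (quotient_of r) \<le> Q \<and> \<bar>\<xi> - of_rat r\<bar> < 1}"
proof -
  define M where "M = \<lceil>(\<bar>\<xi>\<bar> + 1) * real_of_int \<bar>Q\<bar>\<rceil>"
  have "{r::rat. snd (quotient_of r) \<le> Q \<and> \<bar>\<xi> - of_rat r\<bar> < 1} \<subseteq>
      (\<lambda>(h, k). Rat.Fract h k) ` ({- M..M} \<times> {0..Q})"
  proof clarify
    fix r :: rat assume r: "snd (quotient_of r) \<le> Q" "\<bar>\<xi> - of_rat r\<bar> < 1"
    define h k where "h = fst (quotient_of r)" and "k = snd (quotient_of r)"
    have k: "k > 0" by (simp add: k_def quotient_of_denom_pos')
    have "\<bar>real_of_int h / real_of_int k\<bar> \<le> \<bar>\<xi>\<bar> + 1"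
      using r(2) unfolding of_rat_quotient_of h_def k_def by linarith
    hence "\<bar>real_of_int h\<bar> \<le> (\<bar>\<xi>\<bar> + 1) * real_of_int k"
      using k by (simp add: abs_divide pos_divide_le_eq)
    also have "\<dots> \<le> (\<bar>\<xi>\<bar> + 1) * real_of_int \<bar>Q\<bar>"
      using r(1) by (intro mult_left_mono) (auto simp: k_def)
    also have "\<dots> \<le> real_of_int M" unfolding M_def by (rule le_of_int_ceiling)
    finally have "\<bar>h\<bar> \<le> M" by linarith
    moreover have "r = Rat.Fract h k" by (simp add: h_def k_def)
    ultimately show "r \<in> (\<lambda>(h, k). Rat.Fract h k) ` ({- M..M} \<times> {0..Q})"
      using k r(1) by (intro image_eqI[where x = "(h, k)"]) (auto simp: k_def abs_le_iff)
  qed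
  thus ?thesis by (rule finite_subset) auto
qed

text \<open>Forms are demanded at every large real scale \<open>X\<close>, so that \<open>X\<close>
  can be matched to an arbitrary denominator. The lower bound handles the case in which
  \<open>p/q\<close> is itself the rational to be compared with \<open>\<xi>\<close>.\<close>

definition dense_linear_forms :: "real \<Rightarrow> bool" where
  "dense_linear_forms \<xi> \<longleftrightarrow> (\<forall>\<epsilon>>0. \<exists>X0. \<forall>X\<ge>X0. \<exists>p q :: int. \<bar>real_of_int q\<bar> \<le> X powr (1 + \<epsilon>) \<and>
     X powr (- 1 - \<epsilon>) \<le> \<bar>real_of_int q * \<xi> - real_of_int p\<bar> \<and> \<bar>real_of_int q * \<xi> - real_of_int p\<bar> \<le> 1 / X)"

text \<open>For \<open>\<xi> = h/k\<close> a nonzero form has size at least \<open>1/k\<close>,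
  whereas the forms are nonzero and tend to 0.\<close>

lemma dense_linear_forms_irrational:
  assumes "dense_linear_forms \<xi>"
  shows "\<xi> \<notin> \<rat>"
proof
  assume "\<xi> \<in> \<rat>"
  then obtain r where "\<xi> = of_rat r" by (auto elim: Rats_cases)
  define h k where "h = fst (quotient_of r)" and "k = snd (quotient_of r)"
  have k: "k > 0" by (simp add: k_def quotient_of_denom_pos')
  have \<xi>: "\<xi> = h / k" by (simp add: \<open>\<xi> = of_rat r\<close> h_def k_def of_rat_quotient_of)
  obtain X0 where X0: "\<And>X. X \<ge> X0 \<Longrightarrow> \<exists>p q :: int. \<bar>real_of_int q\<bar> \<le> X powr (1 + 1) \<and>
     X powr (- 1 - 1) \<le> \<bar>real_of_int q * \<xi> - real_of_int p\<bar> \<and> \<bar>real_of_int q * \<xi> - real_of_int p\<bar> \<le> 1 / X"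
    using assms[unfolded dense_linear_forms_def, rule_format, of 1] by auto
  define X where "X = max X0 (k + 1)"
  have X: "X \<ge> X0" "X > k" "X > 0" using k by (auto simp: X_def)
  obtain p q :: int where pq: "X powr (- 1 - 1) \<le> \<bar>q * \<xi> - p\<bar>" "\<bar>q * \<xi> - p\<bar> \<le> 1 / X"
    using X0[OF X(1)] by blast
  have eq: "q * \<xi> - p = real_of_int (q * h - p * k) / k" using k by (simp add: \<xi> field_simps)
  have "X powr (- 1 - 1) > 0" using X by simp
  hence "q * \<xi> - p \<noteq> 0" using pq(1) by linarith
  hence "real_of_int (q * h - p * k) \<noteq> 0" using eq by auto
  hence "q * h - p * k \<noteq> 0" by (simp only: of_int_eq_0_iff not_False_eq_True)
  hence "1 \<le> \<bar>real_of_int (q * h - p * k)\<bar>" by linarith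
  hence "1 / k \<le> \<bar>q * \<xi> - p\<bar>" unfolding eq using k by (simp add: abs_divide divide_right_mono)
  also have "\<dots> \<le> 1 / X" by fact
  also have "\<dots> < 1 / k" using X k by (simp add: frac_less2)
  finally show False by simp
qed

text \<open>A rational \<open>h/k\<close> is compared with the form at scale \<open>2 k\<close>. If
  \<open>p k = q h\<close>, the form equals \<open>q (\<xi> - h/k)\<close> and its lower bound keeps
  \<open>h/k\<close> away from \<open>\<xi>\<close>. Otherwise
  \<open>\<bar>p k - q h\<bar> \<ge> 1\<close>, and the form accounts for at most half of this, so
  \<open>q (\<xi> - h/k)\<close> supplies the rest.\<close>

lemma dense_linear_forms_exponent_le_2:
  assumes "dense_linear_forms \<xi>"
  shows "irrationality_exponent \<xi> \<le> 2"
proof -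
  have "\<mu> \<le> 2" if inf: "infinite {r::rat. \<bar>\<xi> - of_rat r\<bar> < real_of_int (snd (quotient_of r)) powr (- \<mu>)}" for \<mu>
  proof (rule ccontr)
    assume "\<not> \<mu> \<le> 2"
    \<comment> \<open>With \<open>\<mu> = 2 + 4 \<epsilon>\<close> the two cases below end with the
      exponents \<open>2 + 2 \<epsilon> - \<mu> = - 2 \<epsilon>\<close> and
      \<open>2 + \<epsilon> - \<mu> = - 3 \<epsilon>\<close> of the denominator.\<close>
    define \<epsilon> where "\<epsilon> = (\<mu> - 2) / 4"
    have \<epsilon>: "\<epsilon> > 0" and \<mu>: "\<mu> = 2 + 4 * \<epsilon>" using \<open>\<not> \<mu> \<le> 2\<close> by (auto simp: \<epsilon>_def field_simps)
    obtain X0 where X0: "\<And>X. X \<ge> X0 \<Longrightarrow> \<exists>p q :: int. \<bar>real_of_int q\<bar> \<le> X powr (1 + \<epsilon>) \<and>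
     X powr (- 1 - \<epsilon>) \<le> \<bar>real_of_int q * \<xi> - real_of_int p\<bar> \<and> \<bar>real_of_int q * \<xi> - real_of_int p\<bar> \<le> 1 / X"
      using assms \<epsilon> unfolding dense_linear_forms_def by meson
    have "((\<lambda>x::real. 2 powr (1 + \<epsilon>) * x powr (- (3 * \<epsilon>))) \<longlongrightarrow> 2 powr (1 + \<epsilon>) * 0) at_top"
      using \<epsilon> by (intro tendsto_mult tendsto_const tendsto_neg_powr filterlim_ident) auto
    hence ev1: "eventually (\<lambda>x::real. 2 powr (1 + \<epsilon>) * x powr (- (3 * \<epsilon>)) < 1 / 2) at_top"
      by (rule order_tendstoD) auto
    have "((\<lambda>x::real. 2 powr (2 + 2 * \<epsilon>) * x powr (- (2 * \<epsilon>))) \<longlongrightarrow> 2 powr (2 + 2 * \<epsilon>) * 0) at_top"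
      using \<epsilon> by (intro tendsto_mult tendsto_const tendsto_neg_powr filterlim_ident) auto
    hence ev2: "eventually (\<lambda>x::real. 2 powr (2 + 2 * \<epsilon>) * x powr (- (2 * \<epsilon>)) < 1) at_top"
      by (rule order_tendstoD) auto
    have "eventually (\<lambda>x::real. 2 powr (1 + \<epsilon>) * x powr (- (3 * \<epsilon>)) < 1 / 2 \<and>
        2 powr (2 + 2 * \<epsilon>) * x powr (- (2 * \<epsilon>)) < 1 \<and> x \<ge> max X0 1) at_top"
      by (intro eventually_conj ev1 ev2 eventually_ge_at_top)
    then obtain x0 where x0: "\<And>x::real. x \<ge> x0 \<Longrightarrow> 2 powr (1 + \<epsilon>) * x powr (- (3 * \<epsilon>)) < 1 / 2 \<and>
        2 powr (2 + 2 * \<epsilon>) * x powr (- (2 * \<epsilon>)) < 1 \<and> x \<ge> max X0 1"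
      unfolding eventually_at_top_linorder by blast
    have "{r::rat. \<bar>\<xi> - of_rat r\<bar> < real_of_int (snd (quotient_of r)) powr (- \<mu>)} \<subseteq>
        {r::rat. snd (quotient_of r) \<le> \<lceil>x0\<rceil> \<and> \<bar>\<xi> - of_rat r\<bar> < 1}"
    proof clarify
      fix r :: rat assume r: "\<bar>\<xi> - of_rat r\<bar> < real_of_int (snd (quotient_of r)) powr (- \<mu>)"
      define h k where "h = fst (quotient_of r)" and "k = snd (quotient_of r)"
      define y where "y = real_of_int k"
      have "k > 0" by (simp add: k_def quotient_of_denom_pos')
      hence y: "y \<ge> 1" by (simp add: y_def)
      have r': "\<bar>\<xi> - h / y\<bar> < y powr (- \<mu>)"
        using r by (simp add: h_def k_def y_def of_rat_quotient_of)
      have "y powr (- \<mu>) \<le> 1" using y \<mu> \<epsilon> powr_mono[of "- \<mu>" 0 y] by simp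
      hence 1: "\<bar>\<xi> - of_rat r\<bar> < 1" using r unfolding y_def k_def by linarith
      have "\<not> y > x0"
      proof
        assume "y > x0"
        hence bd: "2 powr (1 + \<epsilon>) * y powr (- (3 * \<epsilon>)) < 1 / 2"
          "2 powr (2 + 2 * \<epsilon>) * y powr (- (2 * \<epsilon>)) < 1" "y \<ge> X0" using x0[of y] by auto
        \<comment> \<open>The factor 2 turns the upper bound \<open>1 / X\<close> into
          \<open>y * \<bar>q * \<xi> - p\<bar> \<le> 1 / 2\<close>.\<close>
        define X where "X = 2 * y"
        have "X \<ge> X0" using bd(3) y by (simp add: X_def)
        then obtain p q :: int where pq: "\<bar>real_of_int q\<bar> \<le> X powr (1 + \<epsilon>)" "X powr (- 1 - \<epsilon>) \<le> \<bar>q * \<xi> - p\<bar>"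
          "\<bar>q * \<xi> - p\<bar> \<le> 1 / X" using X0 by blast
        have dist: "\<bar>real_of_int q\<bar> * \<bar>\<xi> - h / y\<bar> < X powr (1 + \<epsilon>) * y powr (- \<mu>)"
        proof -
          have "\<bar>real_of_int q\<bar> * \<bar>\<xi> - h / y\<bar> \<le> X powr (1 + \<epsilon>) * \<bar>\<xi> - h / y\<bar>"
            using pq(1) by (intro mult_right_mono) auto
          also have "\<dots> < X powr (1 + \<epsilon>) * y powr (- \<mu>)"
            using r' y by (intro mult_strict_left_mono) (auto simp: X_def)
          finally show ?thesis .
        qed
        show False
        proof (cases "p * k = q * h")
          case True
          hence "real_of_int p * y = real_of_int q * real_of_int h"
            unfolding y_def by (metis of_int_mult)
          hence "q * \<xi> - p = q * (\<xi> - h / y)" using y by (simp add: field_simps)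
          hence "X powr (- 1 - \<epsilon>) < X powr (1 + \<epsilon>) * y powr (- \<mu>)"
            using pq(2) dist by (simp add: abs_mult)
          hence "1 < X powr (1 + \<epsilon>) * y powr (- \<mu>) * X powr (1 + \<epsilon>)"
            using y mult_strict_right_mono[of "X powr (- 1 - \<epsilon>)" "X powr (1 + \<epsilon>) * y powr (- \<mu>)" "X powr (1 + \<epsilon>)"]
            by (simp add: X_def powr_add[symmetric])
          also have "\<dots> = X powr (2 + 2 * \<epsilon>) * y powr (- \<mu>)"
            by (simp add: mult.assoc mult.commute[of "y powr _"]) (simp add: mult.assoc[symmetric] powr_add[symmetric])
          also have "\<dots> = 2 powr (2 + 2 * \<epsilon>) * y powr (- (2 * \<epsilon>))"
            using y by (simp add: X_def \<mu> powr_mult mult.assoc powr_add[symmetric])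
          finally show False using bd(2) by simp
        next
          case False
          hence "1 \<le> \<bar>real_of_int (p * k - q * h)\<bar>" by linarith
          also have "real_of_int (p * k - q * h) = y * (p - q * \<xi>) + q * (y * (\<xi> - h / y))"
            using y by (simp add: y_def field_simps)
          also have "\<bar>\<dots>\<bar> \<le> y * \<bar>q * \<xi> - p\<bar> + y * (\<bar>real_of_int q\<bar> * \<bar>\<xi> - h / y\<bar>)"
            using abs_triangle_ineq[of "y * (p - q * \<xi>)" "q * (y * (\<xi> - h / y))"] y
            by (simp add: abs_mult abs_minus_commute mult_ac)
          also have "y * \<bar>q * \<xi> - p\<bar> \<le> 1 / 2"
            using pq(3) y by (simp add: X_def field_simps)
          also have "y * (\<bar>real_of_int q\<bar> * \<bar>\<xi> - h / y\<bar>) \<le> y * (X powr (1 + \<epsilon>) * y powr (- \<mu>))"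
            using dist y by (intro mult_left_mono) auto
          also have "\<dots> = 2 powr (1 + \<epsilon>) * (y powr 1 * y powr (1 + \<epsilon>) * y powr (- \<mu>))"
            using y by (simp add: X_def powr_mult)
          also have "\<dots> = 2 powr (1 + \<epsilon>) * y powr (- (3 * \<epsilon>))"
            unfolding powr_add[symmetric] by (simp add: \<mu> algebra_simps)
          finally show False using bd(1) by simp
        qed
      qed
      hence "k \<le> \<lceil>x0\<rceil>" unfolding y_def by linarith
      thus "snd (quotient_of r) \<le> \<lceil>x0\<rceil> \<and> \<bar>\<xi> - of_rat r\<bar> < 1" using 1 by (simp add: k_def)
    qed
    hence "finite {r::rat. \<bar>\<xi> - of_rat r\<bar> < real_of_int (snd (quotient_of r)) powr (- \<mu>)}"
      using finite_rats_near finite_subset by blast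
    thus False using inf by simp
  qed
  thus ?thesis unfolding irrationality_exponent_def by (intro Sup_least) auto
qed

section \<open>Integer power series on the unit disc\<close>

text \<open>The target ring is left open because the same series is evaluated at real orbit points
  and, for Parseval, at complex points.\<close>

definition of_int_fps :: "int fps \<Rightarrow> 'a::ring_1 fps" where
  "of_int_fps g = Abs_fps (\<lambda>n. of_int (fps_nth g n))"

definition conv_unit_disc :: "int fps \<Rightarrow> bool" where
  "conv_unit_disc g \<longleftrightarrow> fps_conv_radius (of_int_fps g :: real fps) \<ge> 1"

definition ieval :: "int fps \<Rightarrow> 'a::{banach, real_normed_field} \<Rightarrow> 'a" where
  "ieval g z = eval_fps (of_int_fps g) z"

lemma of_int_fps_nth [simp]: "fps_nth (of_int_fps g) n = of_int (fps_nth g n)"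
  by (simp add: of_int_fps_def)

lemma of_int_fps_add: "of_int_fps (g + h) = of_int_fps g + of_int_fps h"
  by (intro fps_ext) simp

lemma of_int_fps_mult: "of_int_fps (g * h) = of_int_fps g * of_int_fps h"
  by (intro fps_ext) (simp add: fps_mult_nth)

lemma of_int_fps_poly: "of_int_fps (fps_of_poly p) = fps_of_poly (map_poly of_int p)"
  by (intro fps_ext) (simp add: coeff_map_poly)

lemma conv_radius_of_int_fps:
  "fps_conv_radius (of_int_fps g :: 'a::{banach, real_normed_field} fps)
     = fps_conv_radius (of_int_fps g :: real fps)"
proof -
  have "Abs_fps (\<lambda>n. norm (fps_nth (of_int_fps g :: 'a fps) n)) = Abs_fps (\<lambda>n. norm (fps_nth (of_int_fps g :: real fps) n))"
    by (intro fps_ext) simp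
  thus ?thesis by (metis fps_conv_radius_norm)
qed

lemma conv_unit_disc_conv_radius:
  assumes "conv_unit_disc g"
  shows "fps_conv_radius (of_int_fps g :: 'a::{banach, real_normed_field} fps) \<ge> 1"
  using assms by (simp add: conv_unit_disc_def conv_radius_of_int_fps[where ?'a = 'a])

lemma conv_unit_disc_less_conv_radius:
  fixes z :: "'a::{banach, real_normed_field}"
  assumes "conv_unit_disc g" "norm z < 1"
  shows "ereal (norm z) < fps_conv_radius (of_int_fps g :: 'a fps)"
proof -
  have "ereal (norm z) < 1" using assms(2) by simp
  thus ?thesis using conv_unit_disc_conv_radius[OF assms(1), where ?'a = 'a] by (rule less_le_trans)
qed

lemma conv_unit_disc_add: "conv_unit_disc g \<Longrightarrow> conv_unit_disc h \<Longrightarrow> conv_unit_disc (g + h)"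
  unfolding conv_unit_disc_def of_int_fps_add by (rule order_trans[OF _ fps_conv_radius_add]) simp

lemma conv_unit_disc_mult: "conv_unit_disc g \<Longrightarrow> conv_unit_disc h \<Longrightarrow> conv_unit_disc (g * h)"
  unfolding conv_unit_disc_def of_int_fps_mult by (rule order_trans[OF _ fps_conv_radius_mult]) simp

lemma conv_unit_disc_poly: "conv_unit_disc (fps_of_poly p)"
  by (simp add: conv_unit_disc_def of_int_fps_poly)

lemma conv_unit_disc_0: "conv_unit_disc 0" and conv_unit_disc_1: "conv_unit_disc 1"
  using conv_unit_disc_poly[of 0] conv_unit_disc_poly[of 1] by simp_all

lemma conv_unit_disc_power: "conv_unit_disc g \<Longrightarrow> conv_unit_disc (g ^ k)"
  by (induction k) (auto intro: conv_unit_disc_1 conv_unit_disc_mult)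

lemma conv_unit_disc_sum: "(\<And>i. i \<in> I \<Longrightarrow> conv_unit_disc (g i)) \<Longrightarrow> conv_unit_disc (\<Sum>i\<in>I. g i)"
  by (induction I rule: infinite_finite_induct) (auto intro: conv_unit_disc_0 conv_unit_disc_add)

text \<open>This is how the finiteness of the set of values of \<open>c\<close> enters.\<close>

lemma conv_unit_disc_bounded:
  assumes "\<And>n. \<bar>fps_nth g n\<bar> \<le> K"
  shows "conv_unit_disc g"
  unfolding conv_unit_disc_def fps_conv_radius_def
proof (rule conv_radius_geI_ex)
  fix r :: real assume r: "0 < r" "ereal r < 1"
  have "summable (\<lambda>n. real_of_int (fps_nth g n) * r ^ n)"
  proof (rule summable_comparison_test')
    show "summable (\<lambda>n. real_of_int K * r ^ n)" using r by (intro summable_mult summable_geometric) auto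
    fix n show "norm (real_of_int (fps_nth g n) * r ^ n) \<le> real_of_int K * r ^ n"
      using r assms[of n] by (simp add: abs_mult mult_right_mono)
  qed
  thus "\<exists>z. norm z = r \<and> summable (\<lambda>n. fps_nth (of_int_fps g :: real fps) n * z ^ n)"
    using r by (intro exI[of _ r]) simp
qed

lemma ieval_add:
  "conv_unit_disc g \<Longrightarrow> conv_unit_disc h \<Longrightarrow> norm z < 1 \<Longrightarrow> ieval (g + h) z = ieval g z + ieval h z"
  unfolding ieval_def of_int_fps_add by (intro eval_fps_add conv_unit_disc_less_conv_radius)

lemma ieval_mult:
  "conv_unit_disc g \<Longrightarrow> conv_unit_disc h \<Longrightarrow> norm z < 1 \<Longrightarrow> ieval (g * h) z = ieval g z * ieval h z"
  unfolding ieval_def of_int_fps_mult by (intro eval_fps_mult conv_unit_disc_less_conv_radius)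

lemma ieval_poly: "ieval (fps_of_poly p) z = poly (map_poly of_int p) z"
  by (simp add: ieval_def of_int_fps_poly)

lemma ieval_0: "ieval 0 z = 0" and ieval_1: "ieval 1 z = 1"
  using ieval_poly[of 0 z] ieval_poly[of 1 z] by (simp_all add: map_poly_pCons flip: one_pCons)

lemma ieval_power: "conv_unit_disc g \<Longrightarrow> norm z < 1 \<Longrightarrow> ieval (g ^ k) z = ieval g z ^ k"
  by (induction k) (simp_all add: ieval_1 ieval_mult conv_unit_disc_power)

lemma ieval_sum:
  "(\<And>i. i \<in> I \<Longrightarrow> conv_unit_disc (g i)) \<Longrightarrow> norm z < 1 \<Longrightarrow> ieval (\<Sum>i\<in>I. g i) z = (\<Sum>i\<in>I. ieval (g i) z)"
  by (induction I rule: infinite_finite_induct) (auto simp: ieval_0 ieval_add conv_unit_disc_sum)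

lemma ieval_suminf: "ieval g z = (\<Sum>n. of_int (fps_nth g n) * z ^ n)"
  by (simp add: ieval_def eval_fps_def)

lemma conv_unit_disc_summable:
  fixes z :: "'a::{banach, real_normed_field}"
  assumes "conv_unit_disc g" "norm z < 1"
  shows "summable (\<lambda>n. norm (of_int (fps_nth g n) * z ^ n))"
  using norm_summable_fps[OF conv_unit_disc_less_conv_radius[OF assms]] by simp

lemma isCont_ieval:
  fixes z :: "'a::{banach, real_normed_field}"
  assumes "conv_unit_disc g" "norm z < 1"
  shows "isCont (ieval g) z"
proof -
  have "continuous_on (ball 0 1) (ieval g :: 'a \<Rightarrow> 'a)"
    unfolding ieval_def
    by (intro continuous_intros) (auto simp: in_eball_iff intro!: conv_unit_disc_less_conv_radius[OF assms(1)])
  thus ?thesis using assms(2) by (simp add: continuous_on_eq_continuous_at)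
qed

text \<open>After division by \<open>z ^ h\<close> the series has a nonzero constant term, and
  continuity at 0 does the rest. This converts an order of vanishing into a size at
  \<open>1/t\<close>, and in particular into nonvanishing there.\<close>

lemma ieval_leading_term:
  assumes g: "conv_unit_disc g" and h: "fps_nth g h \<noteq> 0" "\<And>j. j < h \<Longrightarrow> fps_nth g j = 0"
  obtains c C \<delta> :: real where "c > 0" "\<delta> > 0"
    "\<And>z::real. 0 < z \<Longrightarrow> z < \<delta> \<Longrightarrow> c * z ^ h \<le> \<bar>ieval g z\<bar> \<and> \<bar>ieval g z\<bar> \<le> C * z ^ h"
proof -
  define u where "u = fps_shift h g"
  have "of_int_fps u = fps_shift h (of_int_fps g :: real fps)" by (intro fps_ext) (simp add: u_def)
  hence u: "conv_unit_disc u" using g by (simp add: conv_unit_disc_def)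
  have "g = fps_X ^ h * u"
    using h(2) by (intro fps_ext) (simp add: fps_X_power_mult_nth u_def)
  hence gu: "g = fps_of_poly (monom 1 h) * u" by (simp add: fps_of_poly_monom')
  have evg: "ieval g z = z ^ h * ieval u z" if "norm z < 1" for z :: real
    unfolding gu using that by (simp add: ieval_mult[OF conv_unit_disc_poly u] ieval_poly map_poly_monom poly_monom)
  define a where "a = \<bar>ieval u (0::real)\<bar>"
  have "ieval u (0::real) = of_int (fps_nth u 0)" by (simp add: ieval_def eval_fps_at_0)
  hence a: "a > 0" using h(1) by (simp add: a_def u_def)
  have "((\<lambda>z. \<bar>ieval u z\<bar>) \<longlongrightarrow> a) (at (0::real))"
    unfolding a_def using isCont_ieval[OF u, of "0::real"] by (intro tendsto_rabs) (simp add: isCont_def)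
  hence "eventually (\<lambda>z::real. \<bar>\<bar>ieval u z\<bar> - a\<bar> < a / 2) (at 0)"
    using a tendstoD[of _ a _ "a / 2"] by (simp add: dist_real_def)
  then obtain \<delta> where \<delta>: "\<delta> > 0" "\<And>z::real. z \<noteq> 0 \<Longrightarrow> \<bar>z\<bar> < \<delta> \<Longrightarrow> \<bar>\<bar>ieval u z\<bar> - a\<bar> < a / 2"
    unfolding eventually_at by (auto simp: dist_real_def)
  show ?thesis
  proof (rule that[of "a / 2" "min \<delta> 1" "2 * a"])
    fix z :: real assume z: "0 < z" "z < min \<delta> 1"
    have "\<bar>\<bar>ieval u z\<bar> - a\<bar> < a / 2" using \<delta>(2)[of z] z by simp
    hence "a / 2 \<le> \<bar>ieval u z\<bar>" "\<bar>ieval u z\<bar> \<le> 2 * a" using a by arith+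
    moreover have "\<bar>ieval g z\<bar> = \<bar>ieval u z\<bar> * z ^ h" using z by (simp add: evg abs_mult)
    ultimately show "a / 2 * z ^ h \<le> \<bar>ieval g z\<bar> \<and> \<bar>ieval g z\<bar> \<le> 2 * a * z ^ h"
      using z by (auto intro!: mult_right_mono)
  qed (use a \<delta> in auto)
qed

section \<open>Hankel determinants and Pade forms\<close>

text \<open>The coefficients \<open>n - 1, ..., 2 n - 2\<close> of \<open>Q f\<close> are the Hankel
  matrix applied to the reversed coefficient vector of \<open>Q\<close>; they cannot all be zero
  when the matrix is nonsingular.\<close>

lemma hankel_det_order_bound:
  fixes Q :: "int poly"
  assumes H: "hankel_det c n \<noteq> 0" and Q: "Q \<noteq> 0" "degree Q < n"
  shows "\<exists>i<n. fps_nth (fps_of_poly Q * Abs_fps c) (n - 1 + i) \<noteq> 0"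
proof (rule ccontr)
  assume no: "\<not> ?thesis"
  have zero: "fps_nth (fps_of_poly Q * Abs_fps c) (n - 1 + i) = 0" if "i < n" for i
    using that no by blast
  define v where "v = (\<lambda>j. coeff Q (n - 1 - j))"
  have "v (n - 1 - degree Q) \<noteq> 0" using Q by (simp add: v_def)
  hence "\<exists>j<n. v j \<noteq> 0" using Q(2) by (intro exI[of _ "n - 1 - degree Q"]) auto
  moreover have "(\<Sum>j<n. c (i + j) * v j) = 0" if "i < n" for i
  proof -
    have "0 = (\<Sum>k\<le>n - 1 + i. coeff Q k * c (n - 1 + i - k))"
      using zero[OF that] by (simp add: fps_mult_nth atLeast0AtMost)
    also have "\<dots> = (\<Sum>k<n. coeff Q k * c (n - 1 + i - k))"
      using Q(2) that by (intro sum.mono_neutral_right) (auto simp: coeff_eq_0)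
    also have "\<dots> = (\<Sum>j<n. coeff Q (n - Suc j) * c (n - 1 + i - (n - Suc j)))"
      by (rule sum.nat_diff_reindex[symmetric])
    also have "\<dots> = (\<Sum>j<n. c (i + j) * v j)"
      by (intro sum.cong) (auto simp: v_def intro!: arg_cong[of _ _ c])
    finally show ?thesis by simp
  qed
  ultimately have "det (mat n n (\<lambda>(i, j). c (i + j))) = 0"
    unfolding det_eq_0_iff_kernel[of n "\<lambda>i j. c (i + j)"] by blast
  thus False using H by (simp add: hankel_det_def)
qed

lemma coeff_sum_monom: "coeff (\<Sum>j<n. monom (q j) j) k = (if k < n then q k else 0)"
  by (simp add: coeff_sum sum.delta)

lemma degree_sum_monom_less: "n > 0 \<Longrightarrow> degree (\<Sum>j<n. monom (q j) j) < n"
  by (rule le_less_trans[OF degree_le[where n = "n - 1"]]) (auto simp: coeff_sum_monom)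

text \<open>The \<open>n + 1\<close> coefficients of \<open>Q\<close> solve the \<open>n\<close>
  equations that kill the coefficients \<open>n, ..., 2 n - 1\<close> of \<open>Q f\<close>, and
  \<open>P\<close> is the truncation of \<open>Q f\<close> below \<open>n\<close>.\<close>

lemma pade_form:
  assumes n: "n < n'" and H: "hankel_det c n' \<noteq> 0"
  obtains P Q :: "int poly" and h where "degree Q \<le> n" "degree P \<le> n"
    "2 * n \<le> h" "h < n + n'"
    "fps_nth (fps_of_poly Q * Abs_fps c - fps_of_poly P) h \<noteq> 0"
    "\<And>j. j < h \<Longrightarrow> fps_nth (fps_of_poly Q * Abs_fps c - fps_of_poly P) j = 0"
proof -
  obtain q :: "nat \<Rightarrow> int" where q: "\<exists>j<Suc n. q j \<noteq> 0"
    "\<And>i. i < n \<Longrightarrow> (\<Sum>j<Suc n. c (n + i - j) * q j) = 0"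
    using underdetermined_int_system[of n "Suc n" "\<lambda>i j. c (n + i - j)"] by auto
  define Q where "Q = (\<Sum>j<Suc n. monom (q j) j)"
  have coeffQ: "coeff Q k = (if k < Suc n then q k else 0)" for k
    unfolding Q_def by (rule coeff_sum_monom)
  have Q: "Q \<noteq> 0" "degree Q \<le> n"
    using q(1) coeffQ degree_sum_monom_less[of "Suc n" q] by (metis coeff_0, simp add: Q_def)
  define R where "R = fps_of_poly Q * Abs_fps c"
  define P where "P = (\<Sum>j<n. monom (fps_nth R j) j)"
  have P: "degree P \<le> n"
    using degree_sum_monom_less[of n "fps_nth R"] by (cases "n = 0") (auto simp: P_def)
  have low: "fps_nth (R - fps_of_poly P) j = (if j < n then 0 else fps_nth R j)" for j
    by (simp add: P_def coeff_sum_monom)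
  have mid: "fps_nth R (n + i) = 0" if "i < n" for i
  proof -
    have "fps_nth R (n + i) = (\<Sum>k\<le>n + i. coeff Q k * c (n + i - k))"
      by (simp add: R_def fps_mult_nth atLeast0AtMost)
    also have "\<dots> = (\<Sum>k<Suc n. coeff Q k * c (n + i - k))"
      using that by (intro sum.mono_neutral_right) (auto simp: coeffQ)
    also have "\<dots> = (\<Sum>k<Suc n. c (n + i - k) * q k)"
      by (intro sum.cong) (auto simp: coeffQ)
    finally show ?thesis using q(2)[OF that] by simp
  qed
  \<comment> \<open>Multiplication by the \<open>s\<close>-th power of the variable keeps the degree
    below \<open>n'\<close> and moves coefficient \<open>n + i\<close> to \<open>n' - 1 + i\<close>.
    The window of the Hankel bound of order \<open>n'\<close> thus starts at coefficient
    \<open>n\<close> of \<open>Q f\<close>, just above \<open>P\<close>.\<close>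
  define s where "s = n' - 1 - n"
  have "degree (monom 1 s * Q) < n'"
    using n Q by (simp add: degree_mult_eq degree_monom_eq s_def)
  then obtain i where i: "i < n'" "fps_nth (fps_of_poly (monom 1 s * Q) * Abs_fps c) (n' - 1 + i) \<noteq> 0"
    using hankel_det_order_bound[OF H, of "monom 1 s * Q"] Q(1) by auto
  have "fps_of_poly (monom 1 s * Q) * Abs_fps c = fps_X ^ s * R"
    by (simp add: fps_of_poly_mult fps_of_poly_monom' R_def mult.assoc)
  hence "fps_nth (fps_of_poly (monom 1 s * Q) * Abs_fps c) (n' - 1 + i) = fps_nth R (n + i)"
    using n by (auto simp: fps_X_power_mult_nth s_def add.commute)
  hence top: "fps_nth (R - fps_of_poly P) (n + i) \<noteq> 0" using i(2) low by simp
  define h where "h = (LEAST j. fps_nth (R - fps_of_poly P) j \<noteq> 0)"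
  have h: "fps_nth (R - fps_of_poly P) h \<noteq> 0" unfolding h_def by (rule LeastI) (rule top)
  have "h \<le> n + i" unfolding h_def by (rule Least_le) (rule top)
  moreover have "2 * n \<le> h"
  proof (rule ccontr)
    assume "\<not> ?thesis"
    moreover have "n \<le> h" using h low[of h] by (cases "h < n") auto
    ultimately have "h - n < n" "h = n + (h - n)" by auto
    thus False using h low[of h] mid[of "h - n"] by auto
  qed
  moreover have "fps_nth (R - fps_of_poly P) j = 0" if "j < h" for j
    using not_less_Least[of j "\<lambda>j. fps_nth (R - fps_of_poly P) j \<noteq> 0"] that unfolding h_def by blast
  ultimately show ?thesis using that[of Q P h] Q P h i(1) unfolding R_def by auto
qed

section \<open>Algebraic integer power series\<close>

text \<open>Orthogonality of the \<open>R\<close>-th roots of unity; sampling at these points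
  replaces the integral over a circle.\<close>

lemma discrete_parseval:
  fixes a :: "nat \<Rightarrow> complex"
  assumes R: "R > 0"
  shows "(\<Sum>k<R. (norm (\<Sum>j<R. a j * cis (2 * pi * real k / real R) ^ j))\<^sup>2) = real R * (\<Sum>j<R. (norm (a j))\<^sup>2)"
proof -
  define \<omega> where "\<omega> = (\<lambda>k. cis (2 * pi * real k / real R))"
  have \<omega>_pow: "\<omega> k ^ j = \<omega> j ^ k" for j k
  proof -
    have "real j * (2 * pi * real k / real R) = real k * (2 * pi * real j / real R)"
      by (simp add: mult_ac)
    thus ?thesis by (simp only: \<omega>_def Complex.DeMoivre)
  qed
  have \<omega>_R: "\<omega> j ^ R = 1" for j
    using R cis_multiple_2pi[of "real j"] by (simp only: \<omega>_def Complex.DeMoivre) simp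
  have norm_\<omega>: "\<omega> j * cnj (\<omega> j) = 1" for j by (simp add: \<omega>_def cis_cnj cis_mult)
  have inj: "inj_on \<omega> {..<R}"
    using Complex.bij_betw_roots_unity[OF R] by (simp add: bij_betw_def \<omega>_def)
  have orth: "(\<Sum>k<R. \<omega> k ^ j * cnj (\<omega> k ^ l)) = (if j = l then of_nat R else 0)"
    if "j < R" "l < R" for j l
  proof -
    define \<zeta> where "\<zeta> = \<omega> j * cnj (\<omega> l)"
    have "(\<Sum>k<R. \<omega> k ^ j * cnj (\<omega> k ^ l)) = (\<Sum>k<R. \<zeta> ^ k)"
      unfolding \<omega>_pow[of _ j] \<omega>_pow[of _ l] by (simp add: \<zeta>_def power_mult_distrib)
    also have "\<dots> = (if j = l then of_nat R else 0)"
    proof (cases "j = l")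
      case True
      thus ?thesis by (simp add: \<zeta>_def norm_\<omega>)
    next
      case False
      have "\<zeta> * \<omega> l = \<omega> j" using norm_\<omega>[of l] by (simp add: \<zeta>_def mult_ac)
      hence "\<zeta> \<noteq> 1" using inj that False by (auto dest: inj_onD)
      moreover have "\<zeta> ^ R = \<omega> j ^ R * cnj (\<omega> l ^ R)"
        by (simp add: \<zeta>_def power_mult_distrib)
      hence "\<zeta> ^ R = 1" by (simp only: \<omega>_R) simp
      ultimately show ?thesis using False by (simp add: geometric_sum)
    qed
    finally show ?thesis .
  qed
  have "of_real (\<Sum>k<R. (norm (\<Sum>j<R. a j * \<omega> k ^ j))\<^sup>2)
      = (\<Sum>k<R. (\<Sum>j<R. a j * \<omega> k ^ j) * cnj (\<Sum>l<R. a l * \<omega> k ^ l))"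
    by (simp only: of_real_sum complex_norm_square)
  also have "\<dots> = (\<Sum>k<R. \<Sum>j<R. \<Sum>l<R. a j * cnj (a l) * (\<omega> k ^ j * cnj (\<omega> k ^ l)))"
    by (simp add: sum_product mult_ac)
  also have "\<dots> = (\<Sum>j<R. \<Sum>k<R. \<Sum>l<R. a j * cnj (a l) * (\<omega> k ^ j * cnj (\<omega> k ^ l)))"
    by (rule sum.swap)
  also have "\<dots> = (\<Sum>j<R. \<Sum>l<R. \<Sum>k<R. a j * cnj (a l) * (\<omega> k ^ j * cnj (\<omega> k ^ l)))"
    by (rule sum.cong[OF refl]) (rule sum.swap)
  also have "\<dots> = (\<Sum>j<R. \<Sum>l<R. a j * cnj (a l) * (if j = l then of_nat R else 0))"
    by (intro sum.cong refl) (simp add: orth flip: sum_distrib_left del: complex_cnj_power)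
  also have "\<dots> = (\<Sum>j<R. a j * cnj (a j) * of_nat R)"
    by (intro sum.cong refl) (simp add: if_distrib[of "\<lambda>x. _ * x"] cong: if_cong)
  also have "\<dots> = of_real (real R * (\<Sum>j<R. (norm (a j))\<^sup>2))"
    by (simp add: sum_distrib_left complex_norm_square mult_ac del: of_real_power)
  finally show ?thesis unfolding of_real_eq_iff \<omega>_def .
qed

text \<open>On the circle of radius \<open>r < 1\<close> the series is cut at \<open>R\<close> terms
  with a tail \<open>\<tau> R\<close> that is uniform in the argument, and the discrete Parseval
  identity is applied. Then \<open>R\<close> tends to infinity and afterwards \<open>r\<close> to
  1.\<close>

lemma bounded_imp_square_sum_le:
  assumes g: "conv_unit_disc g" and M: "\<And>z::complex. norm z < 1 \<Longrightarrow> norm (ieval g z) \<le> M"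
  shows "(\<Sum>j<J. (real_of_int (fps_nth g j))\<^sup>2) \<le> M\<^sup>2"
proof -
  let ?a = "\<lambda>j. real_of_int (fps_nth g j)"
  have M0: "M \<ge> 0" using order_trans[OF norm_ge_zero M[of 0]] by simp
  have step: "(\<Sum>j<J. (?a j * r ^ j)\<^sup>2) \<le> M\<^sup>2" if r: "0 < r" "r < 1" for r :: real
  proof -
    have sm: "summable (\<lambda>n. \<bar>?a n\<bar> * r ^ n)"
      using conv_unit_disc_summable[OF g, of r] r by (simp add: abs_mult)
    define \<tau> where "\<tau> = (\<lambda>R. \<Sum>n. \<bar>?a (n + R)\<bar> * r ^ (n + R))"
    have \<tau>0: "\<tau> R \<ge> 0" for R 
      unfolding \<tau>_def using r by (intro suminf_nonneg summable_ignore_initial_segment[OF sm]) auto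
    have \<tau>lim: "\<tau> \<longlonglongrightarrow> 0" unfolding \<tau>_def using suminf_exist_split2[OF sm] .
    have bound: "(\<Sum>j<J. (?a j * r ^ j)\<^sup>2) \<le> (M + \<tau> R)\<^sup>2" if R: "R \<ge> J" "R > 0" for R
    proof -
      let ?\<omega> = "\<lambda>k. cis (2 * pi * real k / real R)"
      let ?b = "\<lambda>j. complex_of_real (?a j * r ^ j)"
      have part: "norm (\<Sum>j<R. ?b j * ?\<omega> k ^ j) \<le> M + \<tau> R" for k
      proof -
        define z where "z = complex_of_real r * ?\<omega> k"
        have nz: "norm z = r" using r by (simp add: z_def norm_mult)
        have sz: "summable (\<lambda>n. norm (of_int (fps_nth g n) * z ^ n))"
          using conv_unit_disc_summable[OF g, of z] nz r by simp
        have "ieval g z = (\<Sum>n. of_int (fps_nth g (n + R)) * z ^ (n + R)) + (\<Sum>j<R. of_int (fps_nth g j) * z ^ j)"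
          unfolding ieval_suminf by (rule suminf_split_initial_segment[OF summable_norm_cancel[OF sz]])
        moreover have "norm (\<Sum>n. of_int (fps_nth g (n + R)) * z ^ (n + R)) \<le> \<tau> R"
        proof -
          have "norm (\<Sum>n. of_int (fps_nth g (n + R)) * z ^ (n + R)) \<le> (\<Sum>n. norm (of_int (fps_nth g (n + R)) * z ^ (n + R)))"
            by (rule summable_norm[OF summable_ignore_initial_segment[OF sz, of R]])
          also have "\<dots> = \<tau> R" by (simp add: \<tau>_def norm_mult norm_power nz)
          finally show ?thesis .
        qed
        moreover have "norm (ieval g z) \<le> M" using M[of z] nz r by simp
        moreover have "(\<Sum>j<R. ?b j * ?\<omega> k ^ j) = (\<Sum>j<R. of_int (fps_nth g j) * z ^ j)"
          by (intro sum.cong refl) (simp add: z_def power_mult_distrib mult.assoc)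
        ultimately show ?thesis
          using norm_triangle_ineq4[of "ieval g z" "\<Sum>n. of_int (fps_nth g (n + R)) * z ^ (n + R)"] by simp
      qed
      have "real R * (\<Sum>j<R. (?a j * r ^ j)\<^sup>2) = (\<Sum>k<R. (norm (\<Sum>j<R. ?b j * ?\<omega> k ^ j))\<^sup>2)"
        using discrete_parseval[OF R(2), of ?b] by (simp add: norm_mult norm_power power_mult_distrib del: of_real_mult)
      also have "\<dots> \<le> (\<Sum>k<R. (M + \<tau> R)\<^sup>2)" by (intro sum_mono power_mono part) auto
      also have "\<dots> = real R * (M + \<tau> R)\<^sup>2" by simp
      finally have "(\<Sum>j<R. (?a j * r ^ j)\<^sup>2) \<le> (M + \<tau> R)\<^sup>2" using R(2) by simp
      moreover have "(\<Sum>j<J. (?a j * r ^ j)\<^sup>2) \<le> (\<Sum>j<R. (?a j * r ^ j)\<^sup>2)"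
        using R by (intro sum_mono2) auto
      ultimately show ?thesis by linarith
    qed
    have "(\<lambda>R. (M + \<tau> R)\<^sup>2) \<longlonglongrightarrow> (M + 0)\<^sup>2" by (intro tendsto_intros \<tau>lim)
    moreover have "\<exists>N. \<forall>R\<ge>N. (\<Sum>j<J. (?a j * r ^ j)\<^sup>2) \<le> (M + \<tau> R)\<^sup>2"
      using bound by (intro exI[of _ "max J 1"]) auto
    ultimately show ?thesis using LIMSEQ_le_const by fastforce
  qed
  have "((\<lambda>r. \<Sum>j<J. (?a j * r ^ j)\<^sup>2) \<longlongrightarrow> (\<Sum>j<J. (?a j * 1 ^ j)\<^sup>2)) (at_left (1::real))"
    by (intro tendsto_intros)
  moreover have "eventually (\<lambda>r::real. (\<Sum>j<J. (?a j * r ^ j)\<^sup>2) \<le> M\<^sup>2) (at_left 1)"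
    using eventually_at_left_real[of 0 "1::real"] by (rule eventually_mono) (auto intro!: step)
  ultimately show ?thesis using tendsto_upperbound[of _ _ "at_left (1::real)"] by fastforce
qed

text \<open>A nonzero integer contributes at least 1 to the sum of squares, so at most
  \<open>M\<^sup>2\<close> coefficients are nonzero.\<close>

lemma bounded_imp_polynomial:
  assumes g: "conv_unit_disc g" and M: "\<And>z::complex. norm z < 1 \<Longrightarrow> norm (ieval g z) \<le> M"
  shows "\<exists>J. \<forall>j\<ge>J. fps_nth g j = 0"
proof -
  have "finite {j. fps_nth g j \<noteq> 0}"
  proof (rule ccontr)
    assume inf: "infinite {j. fps_nth g j \<noteq> 0}"
    define K where "K = nat \<lceil>M\<^sup>2\<rceil> + 1"
    obtain S where S: "S \<subseteq> {j. fps_nth g j \<noteq> 0}" "card S = K" "finite S"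
      using infinite_arbitrarily_large[OF inf] by blast
    define J where "J = Suc (Max (insert 0 S))"
    have "S \<subseteq> {..<J}" using S(3) by (auto simp: J_def less_Suc_eq_le)
    have "real K = (\<Sum>j\<in>S. 1)" using S by simp
    also have "\<dots> \<le> (\<Sum>j\<in>S. (real_of_int (fps_nth g j))\<^sup>2)"
    proof (rule sum_mono)
      fix j assume "j \<in> S"
      hence "1 \<le> \<bar>real_of_int (fps_nth g j)\<bar>" using S(1) by (auto simp: abs_if)
      thus "1 \<le> (real_of_int (fps_nth g j))\<^sup>2" by (metis one_le_power power2_abs)
    qed
    also have "\<dots> \<le> (\<Sum>j<J. (real_of_int (fps_nth g j))\<^sup>2)"
      using \<open>S \<subseteq> {..<J}\<close> by (intro sum_mono2) auto
    also have "\<dots> \<le> M\<^sup>2" by (rule bounded_imp_square_sum_le[OF g M])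
    finally show False unfolding K_def by linarith
  qed
  hence "\<forall>j\<ge>Suc (Max (insert 0 {j. fps_nth g j \<noteq> 0})). fps_nth g j = 0"
    by (metis (mono_tags, lifting) Max_ge finite_insert insertI2 mem_Collect_eq not_less_eq_eq)
  thus ?thesis by blast
qed

lemma norm_poly_le_on_disc:
  fixes z :: "'a::{banach, real_normed_field}"
  assumes "norm z \<le> 1"
  shows "norm (poly (map_poly of_int p) z) \<le> (\<Sum>i\<le>degree p. \<bar>real_of_int (coeff p i)\<bar>)"
proof -
  have "poly (map_poly of_int p) z = (\<Sum>i\<le>degree p. of_int (coeff p i) * z ^ i)"
    by (simp add: poly_altdef coeff_map_poly degree_map_poly)
  also have "norm \<dots> \<le> (\<Sum>i\<le>degree p. norm (of_int (coeff p i) * z ^ i))" by (rule norm_sum)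
  also have "\<dots> \<le> (\<Sum>i\<le>degree p. \<bar>real_of_int (coeff p i)\<bar>)"
    using assms by (intro sum_mono) (auto simp: norm_mult norm_power intro!: mult_left_le power_le_one)
  finally show ?thesis .
qed

text \<open>Fatou: clearing the leading coefficient makes an algebraic \<open>f\<close> integral over the polynomials,
  hence bounded on the unit disc.\<close>
lemma algebraic_integer_series_rational:
  fixes P :: "nat \<Rightarrow> int poly"
  assumes f: "conv_unit_disc f" and rel: "(\<Sum>j\<le>N. fps_of_poly (P j) * f ^ j) = 0" and nz: "\<exists>j\<le>N. P j \<noteq> 0"
  obtains Q J where "Q \<noteq> 0" "\<And>j. j \<ge> J \<Longrightarrow> fps_nth (fps_of_poly Q * f) j = 0"
proof -
  define s where "s = Max {j. j \<le> N \<and> P j \<noteq> 0}"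
  have fin: "finite {j. j \<le> N \<and> P j \<noteq> 0}" by simp
  have "s \<in> {j. j \<le> N \<and> P j \<noteq> 0}" unfolding s_def using nz by (intro Max_in) auto
  hence s: "s \<le> N" "P s \<noteq> 0" by auto
  have above: "P j = 0" if "s < j" "j \<le> N" for j
    using Max_ge[OF fin, of j] that unfolding s_def[symmetric] by auto
  have rel': "(\<Sum>j\<le>s. fps_of_poly (P j) * f ^ j) = 0"
    unfolding rel[symmetric] using s above by (intro sum.mono_neutral_left) auto
  \<comment> \<open>For \<open>s = 0\<close> the relation would read \<open>P 0 = 0\<close>.\<close>
  have "s > 0"
    using rel' s(2) by (cases s) auto
  define \<Lambda> where "\<Lambda> = 1 + (\<Sum>j\<le>s. \<Sum>i\<le>degree (P j). \<bar>real_of_int (coeff (P j) i)\<bar>)"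
  have \<Lambda>1: "\<Lambda> \<ge> 1" by (simp add: \<Lambda>_def sum_nonneg)
  define g where "g = fps_of_poly (P s) * f"
  have g: "conv_unit_disc g" unfolding g_def by (intro conv_unit_disc_mult conv_unit_disc_poly f)
  have "norm (ieval g z) \<le> real s * \<Lambda> ^ s" if z: "norm z < 1" for z :: complex
  proof -
    define p where "p = (\<lambda>j. poly (map_poly of_int (P j)) z)"
    have p: "norm (p j) \<le> \<Lambda>" if "j \<le> s" for j
    proof -
      have "norm (p j) \<le> (\<Sum>i\<le>degree (P j). \<bar>real_of_int (coeff (P j) i)\<bar>)"
        unfolding p_def using z by (intro norm_poly_le_on_disc) auto
      also have "\<dots> \<le> (\<Sum>j\<le>s. \<Sum>i\<le>degree (P j). \<bar>real_of_int (coeff (P j) i)\<bar>)"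
        using that by (intro member_le_sum[of j "{..s}" "\<lambda>j. \<Sum>i\<le>degree (P j). \<bar>real_of_int (coeff (P j) i)\<bar>"])
          (auto intro: sum_nonneg)
      finally show ?thesis by (simp add: \<Lambda>_def)
    qed
    define w where "w = p s * ieval f z"
    have evg: "ieval g z = w" unfolding g_def w_def p_def using z by (simp add: ieval_mult conv_unit_disc_poly f ieval_poly)
    have "ieval (\<Sum>j\<le>s. fps_of_poly (P j) * f ^ j) z = (\<Sum>j\<le>s. p j * ieval f z ^ j)"
      using z by (simp add: ieval_sum ieval_mult ieval_power ieval_poly conv_unit_disc_mult conv_unit_disc_poly conv_unit_disc_power f p_def)
    hence "(\<Sum>j\<le>s. p j * ieval f z ^ j) = 0" unfolding rel' by (simp add: ieval_0)
    \<comment> \<open>This factor makes the relation monic in \<open>w = p s * f(z)\<close>, with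
      coefficients bounded on the disc.\<close>
    hence "0 = p s ^ (s - 1) * (\<Sum>j\<le>s. p j * ieval f z ^ j)" by simp
    also have "\<dots> = p s ^ (s - 1) * (p s * ieval f z ^ s) + (\<Sum>j<s. p s ^ (s - 1) * (p j * ieval f z ^ j))"
      by (simp add: lessThan_Suc_atMost[symmetric] distrib_left sum_distrib_left)
    also have "p s ^ (s - 1) * (p s * ieval f z ^ s) = w ^ s"
      using \<open>s > 0\<close> by (simp add: w_def power_mult_distrib flip: mult.assoc power_Suc2)
    also have "(\<Sum>j<s. p s ^ (s - 1) * (p j * ieval f z ^ j)) = (\<Sum>j<s. p j * p s ^ (s - 1 - j) * w ^ j)"
    proof (intro sum.cong refl)
      fix j assume "j \<in> {..<s}"
      hence "p s ^ (s - 1) = p s ^ (s - 1 - j) * p s ^ j" by (simp flip: power_add)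
      thus "p s ^ (s - 1) * (p j * ieval f z ^ j) = p j * p s ^ (s - 1 - j) * w ^ j"
        by (simp add: w_def power_mult_distrib)
    qed
    finally have eq: "w ^ s = - (\<Sum>j<s. p j * p s ^ (s - 1 - j) * w ^ j)"
      by (simp add: eq_neg_iff_add_eq_0)
    show ?thesis
    \<comment> \<open>Cauchy's root bound: for \<open>norm w > 1\<close> every power in the sum is
      at most \<open>norm w ^ (s - 1)\<close>, which is then cancelled.\<close>
    proof (cases "norm w \<le> 1")
      case True
      moreover have "1 \<le> real s * \<Lambda> ^ s"
        using \<open>s > 0\<close> \<Lambda>1 mult_mono[of 1 "real s" 1 "\<Lambda> ^ s"] by simp
      ultimately show ?thesis unfolding evg by linarith
    next
      case False
      have "norm w ^ s = norm (\<Sum>j<s. p j * p s ^ (s - 1 - j) * w ^ j)"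
        using arg_cong[OF eq, of norm] by (simp add: norm_power)
      also have "\<dots> \<le> (\<Sum>j<s. norm (p j * p s ^ (s - 1 - j) * w ^ j))" by (rule norm_sum)
      also have "\<dots> \<le> (\<Sum>j<s. \<Lambda> ^ s * norm w ^ (s - 1))"
      proof (rule sum_mono)
        fix j assume j: "j \<in> {..<s}"
        have "norm (p j) * norm (p s) ^ (s - 1 - j) \<le> \<Lambda> ^ 1 * \<Lambda> ^ (s - 1 - j)"
          using p j \<Lambda>1 by (intro mult_mono power_mono) auto
        also have "\<dots> \<le> \<Lambda> ^ s" unfolding power_add[symmetric] using j \<Lambda>1 by (intro power_increasing) auto
        finally have "norm (p j) * norm (p s) ^ (s - 1 - j) \<le> \<Lambda> ^ s" .
        moreover have "norm w ^ j \<le> norm w ^ (s - 1)" using False j by (intro power_increasing) auto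
        ultimately show "norm (p j * p s ^ (s - 1 - j) * w ^ j) \<le> \<Lambda> ^ s * norm w ^ (s - 1)"
          unfolding norm_mult norm_power using \<Lambda>1 by (intro mult_mono) auto
      qed
      also have "\<dots> = real s * \<Lambda> ^ s * norm w ^ (s - 1)" by simp
      also have "norm w ^ s = norm w * norm w ^ (s - 1)" using \<open>s > 0\<close> by (simp flip: power_Suc)
      finally have "norm w * norm w ^ (s - 1) \<le> real s * \<Lambda> ^ s * norm w ^ (s - 1)" .
      moreover have "0 < norm w ^ (s - 1)" using False by (intro zero_less_power) auto
      ultimately show ?thesis unfolding evg by (rule mult_right_le_imp_le)
    qed
  qed
  hence "\<exists>J. \<forall>j\<ge>J. fps_nth g j = 0" by (rule bounded_imp_polynomial[OF g])
  thus ?thesis using that[of "P s"] s(2) unfolding g_def by blast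
qed

text \<open>Otherwise \<open>Q f\<close> would be a polynomial for some \<open>Q \<noteq> 0\<close>,
  whereas a nonzero Hankel determinant of order \<open>n > degree Q + J\<close> gives
  \<open>Q f\<close> a nonzero coefficient at an index at least
  \<open>n - 1 \<ge> J\<close>.\<close>

lemma hankel_imp_transcendental:
  fixes P :: "nat \<Rightarrow> int poly"
  assumes f: "conv_unit_disc (Abs_fps c)" and H: "infinite {n. hankel_det c n \<noteq> 0}" and nz: "\<exists>j\<le>N. P j \<noteq> 0"
  shows "(\<Sum>j\<le>N. fps_of_poly (P j) * Abs_fps c ^ j) \<noteq> 0"
proof
  assume "(\<Sum>j\<le>N. fps_of_poly (P j) * Abs_fps c ^ j) = 0"
  then obtain Q J where Q: "Q \<noteq> 0" "\<And>j. j \<ge> J \<Longrightarrow> fps_nth (fps_of_poly Q * Abs_fps c) j = 0"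
    using algebraic_integer_series_rational[OF f _ nz] by metis
  obtain n where n: "n > degree Q + J" "hankel_det c n \<noteq> 0"
    using H unfolding infinite_nat_iff_unbounded by blast
  obtain i where "fps_nth (fps_of_poly Q * Abs_fps c) (n - 1 + i) \<noteq> 0"
    using hankel_det_order_bound[OF n(2) Q(1)] n(1) by auto
  moreover have "n - 1 + i \<ge> J" using n(1) by linarith
  ultimately show False using Q(2) by blast
qed

section \<open>The Mahler functional equation\<close>

lemma ipoly_conv_ieval: "ipoly p x = ieval (fps_of_poly p) x"
  by (simp add: ipoly_def ieval_poly)

lemma map_poly_of_int_mult:
  "map_poly of_int (p * q) = map_poly of_int p * (map_poly of_int q :: 'a::comm_ring_1 poly)"
  by (intro poly_eqI) (simp add: coeff_map_poly coeff_mult)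

lemma map_poly_of_rat_mult:
  "map_poly of_rat (p * q) = map_poly of_rat p * (map_poly of_rat q :: real poly)"
  by (intro poly_eqI) (simp add: coeff_map_poly coeff_mult of_rat_sum of_rat_mult)

lemma map_poly_of_rat_power: "map_poly of_rat (p ^ k) = (map_poly of_rat p :: real poly) ^ k"
  by (induction k) (simp_all add: map_poly_of_rat_mult)

lemma map_poly_of_int_nonzero: "p \<noteq> 0 \<Longrightarrow> map_poly of_int p \<noteq> (0 :: 'a::ring_char_0 poly)"
  by (simp add: poly_eq_iff coeff_map_poly)

lemma ipoly_mult: "ipoly (p * q) x = ipoly p x * ipoly q x"
  by (simp add: ipoly_def map_poly_of_int_mult)

lemma ipoly_altdef: "ipoly p x = (\<Sum>i\<le>degree p. of_int (coeff p i) * x ^ i)"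
  by (simp add: ipoly_def poly_altdef coeff_map_poly degree_map_poly)

lemma ipoly_of_rat: "ipoly p (of_rat a) = of_rat (poly (map_poly of_int p) a)"
  by (simp add: ipoly_def poly_altdef coeff_map_poly degree_map_poly of_rat_sum of_rat_mult of_rat_power)

lemma isCont_ipoly: "isCont (ipoly p) x"
  unfolding ipoly_def by (intro continuous_intros)

lemma rat_poly_of_rat: "poly (map_poly of_rat p) (of_rat a :: real) = of_rat (poly p a)"
  by (simp add: poly_altdef coeff_map_poly degree_map_poly of_rat_sum of_rat_mult of_rat_power)

lemma ipoly_conv_rat_poly: "ipoly p x = poly (map_poly of_rat (map_poly of_int p)) x"
  by (simp add: ipoly_def poly_altdef coeff_map_poly degree_map_poly)

section \<open>Rational relations at points where \<open>B\<close> or \<open>D\<close> may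
  vanish\<close>

lemma eventually_poly_nonzero:
  fixes p :: "real poly"
  assumes "p \<noteq> 0"
  shows "eventually (\<lambda>x. poly p x \<noteq> 0) (at a)"
proof -
  have "finite {x. poly p x = 0}" by (rule poly_roots_finite[OF assms])
  hence "\<not> a islimpt {x. poly p x = 0}" by (rule islimpt_finite)
  thus ?thesis unfolding islimpt_conv_frequently_at frequently_def by simp
qed

lemma eventually_ipoly_nonzero:
  assumes "p \<noteq> 0"
  shows "eventually (\<lambda>x. ipoly p x \<noteq> 0) (at a)"
  unfolding ipoly_def using assms by (intro eventually_poly_nonzero map_poly_of_int_nonzero)

text \<open>For \<open>k > 0\<close> continuity of \<open>g\<close> forces \<open>P\<close> to
  vanish at \<open>a\<close>, and dividing out \<open>x - a\<close> keeps the coefficients rational.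
  For \<open>k = 0\<close> the value of \<open>g\<close> is the value of \<open>P\<close>.\<close>

lemma rational_removable_quotient:
  fixes P :: "rat poly" and g :: "real \<Rightarrow> real"
  assumes "isCont g (of_rat a)"
    and "eventually (\<lambda>x. (x - of_rat a) ^ k * g x = poly (map_poly of_rat P) x) (at (of_rat a))"
  shows "g (of_rat a) \<in> \<rat>"
  using assms(2)
proof (induction k arbitrary: P)
  case 0
  let ?P = "poly (map_poly of_rat P) :: real \<Rightarrow> real"
  have "(g \<longlongrightarrow> g (of_rat a)) (at (of_rat a))" using assms(1) by (simp add: isCont_def)
  hence "(?P \<longlongrightarrow> g (of_rat a)) (at (of_rat a))"
    by (rule Lim_transform_eventually) (use 0 in \<open>auto elim: eventually_mono\<close>)
  moreover have "(?P \<longlongrightarrow> ?P (of_rat a)) (at (of_rat a))"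
    by (intro tendsto_intros)
  ultimately have "g (of_rat a) = ?P (of_rat a)" using tendsto_unique trivial_limit_at by blast
  thus ?case by (simp add: rat_poly_of_rat)
next
  case (Suc k)
  let ?P = "poly (map_poly of_rat P) :: real \<Rightarrow> real"
  have "((\<lambda>x. (x - of_rat a) ^ Suc k * g x) \<longlongrightarrow> (of_rat a - of_rat a) ^ Suc k * g (of_rat a)) (at (of_rat a))"
    using assms(1) by (intro tendsto_intros) (simp add: isCont_def)
  hence "(?P \<longlongrightarrow> 0) (at (of_rat a))"
    by (intro Lim_transform_eventually[OF _ Suc.prems]) simp
  moreover have "(?P \<longlongrightarrow> ?P (of_rat a)) (at (of_rat a))"
    by (intro tendsto_intros)
  ultimately have "?P (of_rat a) = 0" using tendsto_unique trivial_limit_at by blast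
  hence "poly P a = 0" by (simp add: rat_poly_of_rat)
  then obtain P' where P': "P = [:-a, 1:] * P'" by (metis dvdE poly_eq_0_iff_dvd)
  have Px: "?P x = (x - of_rat a) * poly (map_poly of_rat P') x" for x :: real
    unfolding P' map_poly_of_rat_mult by (simp add: map_poly_pCons of_rat_minus algebra_simps)
  have "eventually (\<lambda>x. (x - of_rat a) ^ k * g x = poly (map_poly of_rat P') x) (at (of_rat a))"
  proof (rule eventually_elim2[OF Suc.prems eventually_neq_at_within[of "of_rat a"]])
    fix x :: real assume "(x - of_rat a) ^ Suc k * g x = ?P x" and ne: "x \<noteq> of_rat a"
    hence "(x - of_rat a) * ((x - of_rat a) ^ k * g x) = (x - of_rat a) * poly (map_poly of_rat P') x"
      by (simp add: Px mult.assoc)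
    thus "(x - of_rat a) ^ k * g x = poly (map_poly of_rat P') x"
      using ne by (simp only: mult_cancel_left right_minus_eq) blast
  qed
  thus ?case by (rule Suc.IH)
qed

text \<open>A pointwise statement on the interval, not a formal identity: at a zero of
  \<open>B\<close> or \<open>D\<close> it can be exploited only through limits.\<close>

definition mahler_equation :: "nat \<Rightarrow> int fps \<Rightarrow> int poly \<Rightarrow> int poly \<Rightarrow> int poly \<Rightarrow> int poly \<Rightarrow> bool" where
  "mahler_equation d f A B C D \<longleftrightarrow> (\<forall>z::real. \<bar>z\<bar> < 1 \<longrightarrow> ipoly B z \<noteq> 0 \<longrightarrow> ipoly D z \<noteq> 0 \<longrightarrow>
     ieval f z = ipoly A z / ipoly B z + ipoly C z / ipoly D z * ieval f (z ^ d))"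

lemma mahler_equation_cleared:
  assumes "mahler_equation d f A B C D" "\<bar>z\<bar> < 1" "ipoly B z \<noteq> 0" "ipoly D z \<noteq> 0"
  shows "ipoly (B * D) z * ieval f z = ipoly (A * D) z + ipoly (C * B) z * ieval f (z ^ d)"
proof -
  have "ieval f z = ipoly A z / ipoly B z + ipoly C z / ipoly D z * ieval f (z ^ d)"
    using assms unfolding mahler_equation_def by blast
  thus ?thesis unfolding ipoly_mult using assms(3,4) by (simp add: field_simps)
qed

text \<open>At a zero \<open>a\<close> of \<open>B\<close> the equation is divided by the full power of \<open>z - a\<close> in \<open>B\<close>; continuity of
  \<open>f\<close> makes the remaining quotient of polynomials rational at \<open>a\<close>.\<close>
lemma mahler_equation_at_rational:
  assumes f: "conv_unit_disc f" and d: "d \<ge> 2" and eq: "mahler_equation d f A B C D"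
    and BD: "B \<noteq> 0" "D \<noteq> 0" and a: "\<bar>of_rat a :: real\<bar> < 1" and C: "ipoly C (of_rat a) \<noteq> 0"
  obtains x y w :: real where "x \<in> \<rat>" "y \<in> \<rat>" "w \<in> \<rat>" "w \<noteq> 0"
    "x * ieval f (of_rat a) = y + w * ieval f (of_rat a ^ d)"
proof -
  define a' :: real where "a' = of_rat a"
  define k where "k = order a (map_poly of_int B)"
  have "map_poly rat_of_int B \<noteq> 0" using BD(1) by (rule map_poly_of_int_nonzero)
  then obtain B1 where B1: "map_poly of_int B = [:-a, 1:] ^ k * B1" "\<not> [:-a, 1:] dvd B1"
    unfolding k_def using order_decomp by blast
  define b1 where "b1 = (\<lambda>x::real. poly (map_poly of_rat B1) x)"
  have Bx: "ipoly B x = (x - a') ^ k * b1 x" for x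
    unfolding ipoly_conv_rat_poly B1 b1_def a'_def
    by (simp add: map_poly_of_rat_mult map_poly_of_rat_power map_poly_pCons of_rat_minus)
  have b1: "b1 a' \<noteq> 0"
    using B1(2) by (simp add: b1_def a'_def rat_poly_of_rat poly_eq_0_iff_dvd)
  have b1_Q: "b1 a' \<in> \<rat>" by (simp add: b1_def a'_def rat_poly_of_rat)
  have ip_Q: "ipoly p a' \<in> \<rat>" for p by (simp add: a'_def ipoly_of_rat)
  \<comment> \<open>Clearing denominators and pulling \<open>(x - a') ^ k\<close> out of
    \<open>B\<close> leaves \<open>(x - a') ^ k * g x = A(x) D(x)\<close> near
    \<open>a'\<close>.\<close>
  define g where "g = (\<lambda>x. b1 x * (ipoly D x * ieval f x - ipoly C x * ieval f (x ^ d)))"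
  have ad: "norm (a' ^ d) < 1" using a d by (simp add: a'_def power_abs power_less_one_iff)
  have "isCont (\<lambda>x. ieval f (x ^ d) :: real) a'"
    by (rule isCont_o2[where g = "ieval f"]) (use isCont_ieval[OF f ad] in auto)
  moreover have "isCont (\<lambda>x. ieval f x :: real) a'" using isCont_ieval[OF f, of a'] a by (simp add: a'_def)
  moreover have "isCont b1 a'" unfolding b1_def by (intro continuous_intros)
  ultimately have "isCont g a'" unfolding g_def using isCont_ipoly[where p = D and x = a'] isCont_ipoly[where p = C and x = a']
    by (intro continuous_intros)
  moreover have "eventually (\<lambda>x. (x - a') ^ k * g x = poly (map_poly of_rat (map_poly of_int (A * D))) x) (at a')"
  proof -
    have "eventually (\<lambda>x::real. x \<in> ball 0 1) (at a')"
      using a by (intro eventually_at_in_open') (auto simp: a'_def)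
    thus ?thesis
      using eventually_ipoly_nonzero[OF BD(1), of a'] eventually_ipoly_nonzero[OF BD(2), of a']
    proof eventually_elim
      case (elim x)
      have "\<bar>x\<bar> < 1" using elim(1) by simp
      from mahler_equation_cleared[OF eq this elim(2,3)]
      show ?case unfolding ipoly_conv_rat_poly[symmetric] g_def
        by (simp add: ipoly_mult Bx algebra_simps)
    qed
  qed
  ultimately have "g a' \<in> \<rat>" unfolding a'_def by (rule rational_removable_quotient)
  show ?thesis
  \<comment> \<open>The coefficient of \<open>f(a)\<close> is zero when \<open>D\<close> vanishes at
    \<open>a\<close>; only the coefficient of \<open>f(a ^ d)\<close> is sure to be nonzero.\<close>
  proof (rule that[of "b1 a' * ipoly D a'" "g a'" "b1 a' * ipoly C a'"])
    show "b1 a' * ipoly D a' * ieval f (of_rat a) = g a' + b1 a' * ipoly C a' * ieval f (of_rat a ^ d)"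
      by (simp add: g_def a'_def[symmetric] algebra_simps)
  qed (use \<open>g a' \<in> \<rat>\<close> b1_Q ip_Q b1 C in \<open>auto simp: a'_def[symmetric]\<close>)
qed

section \<open>Integral relations with coefficients bounded by a fixed power of
  \<open>t\<close>\<close>

lemma ipoly_integral_multiple:
  fixes t :: int
  assumes "degree p \<le> e" "t \<ge> 1"
  shows "\<exists>k::int. of_int k = of_int t ^ e * ipoly p (1 / of_int t) \<and> \<bar>k\<bar> \<le> (\<Sum>i\<le>degree p. \<bar>coeff p i\<bar>) * t ^ e"
proof (intro exI conjI)
  let ?k = "\<Sum>i\<le>degree p. coeff p i * t ^ (e - i)"
  have "of_int t ^ e * ipoly p (1 / of_int t)
      = (\<Sum>i\<le>degree p. of_int (coeff p i) * (of_int t ^ e * (1 / of_int t) ^ i))"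
    by (simp add: ipoly_altdef sum_distrib_left mult_ac)
  also have "\<dots> = (\<Sum>i\<le>degree p. of_int (coeff p i * t ^ (e - i)))"
  proof (intro sum.cong refl)
    fix i assume "i \<in> {..degree p}"
    hence "real_of_int t ^ e = of_int t ^ (e - i) * of_int t ^ i"
      using assms(1) by (simp flip: power_add)
    hence "real_of_int t ^ e * (1 / of_int t) ^ i = of_int t ^ (e - i)"
      using assms(2) by (simp add: power_one_over)
    thus "of_int (coeff p i) * (real_of_int t ^ e * (1 / of_int t) ^ i) = of_int (coeff p i * t ^ (e - i))"
      by simp
  qed
  finally show "of_int ?k = of_int t ^ e * ipoly p (1 / of_int t)" by simp
  have "\<bar>?k\<bar> \<le> (\<Sum>i\<le>degree p. \<bar>coeff p i * t ^ (e - i)\<bar>)" by (rule sum_abs)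
  also have "\<dots> \<le> (\<Sum>i\<le>degree p. \<bar>coeff p i\<bar> * t ^ e)"
    using assms by (intro sum_mono) (auto simp: abs_mult power_abs intro!: mult_left_mono power_increasing)
  finally show "\<bar>?k\<bar> \<le> (\<Sum>i\<le>degree p. \<bar>coeff p i\<bar>) * t ^ e" by (simp add: sum_distrib_right)
qed

lemma eventually_ipoly_nonzero_at_0:
  assumes "p \<noteq> 0"
  obtains \<delta> where "\<delta> > 0" "\<And>x. 0 < x \<Longrightarrow> x < \<delta> \<Longrightarrow> ipoly p x \<noteq> 0"
  using eventually_ipoly_nonzero[OF assms, of 0] unfolding eventually_at
  by (auto simp: dist_real_def)

text \<open>Used with \<open>F m = f(1/t)\<close>, \<open>t = b\<^bsup>d^m\<^esup>\<close>; the point is that \<open>K\<close> does not depend on \<open>m\<close>.\<close>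
definition affine_orbit :: "nat \<Rightarrow> nat \<Rightarrow> (nat \<Rightarrow> real) \<Rightarrow> real \<Rightarrow> bool" where
  "affine_orbit b d F \<xi> \<longleftrightarrow> (\<exists>K m0. \<forall>m\<ge>m0. \<exists>U V W :: int. V \<noteq> 0 \<and> W \<noteq> 0 \<and>
     \<bar>U\<bar> \<le> (int b ^ d ^ m) ^ K \<and> \<bar>V\<bar> \<le> (int b ^ d ^ m) ^ K \<and> \<bar>W\<bar> \<le> (int b ^ d ^ m) ^ K \<and>
     of_int V * F m = of_int W * \<xi> - of_int U)"

text \<open>Eliminating \<open>F m\<close> between the relation with \<open>\<xi>\<close> and the
  next step gives \<open>V w F (m + 1) = x W \<xi> - (x U + y V)\<close>. The coefficients grow by a
  factor at most \<open>2 t ^ (h + e)\<close>, while \<open>t\<close> becomes \<open>t ^ d\<close>,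
  so the bound \<open>t ^ K\<close> survives as soon as
  \<open>1 + h + e + K \<le> d K\<close>.\<close>

lemma affine_orbitI:
  fixes F :: "nat \<Rightarrow> real" and H :: int
  assumes b: "b \<ge> 2" and d: "d \<ge> 2"
    and steps: "\<And>m. m \<ge> m0 \<Longrightarrow> \<exists>x y w :: int. x \<noteq> 0 \<and> w \<noteq> 0 \<and> \<bar>x\<bar> \<le> H * (int b ^ d ^ m) ^ e \<and>
        \<bar>y\<bar> \<le> H * (int b ^ d ^ m) ^ e \<and> \<bar>w\<bar> \<le> H * (int b ^ d ^ m) ^ e \<and>
        of_int x * F m = of_int y + of_int w * F (Suc m)"
    and base: "of_int V0 * F m0 = of_int W0 * \<xi> - of_int U0" "V0 \<noteq> 0" "W0 \<noteq> 0"
  shows "affine_orbit b d F \<xi>"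
proof -
  let ?t = "\<lambda>m. int b ^ d ^ m"
  have t2: "?t m \<ge> 2" for m
  proof -
    have "(2::int) ^ 1 \<le> int b ^ d ^ m" using b d
      by (intro order_trans[OF power_increasing[of 1 "d ^ m" "2::int"] power_mono]) auto
    thus ?thesis by simp
  qed
  have large: "\<exists>k::nat. x \<le> 2 ^ k" for x :: int
  proof -
    obtain k where "real_of_int x < 2 ^ k" using real_arch_pow[of 2 "real_of_int x"] by auto
    hence "real_of_int x < real_of_int (2 ^ k)" by simp
    hence "x < 2 ^ k" by (simp only: of_int_less_iff)
    thus ?thesis by (intro exI[of _ k]) simp
  qed
  obtain h where h: "H \<le> 2 ^ h" using large by blast
  obtain k0 where k0: "\<bar>U0\<bar> + \<bar>V0\<bar> + \<bar>W0\<bar> \<le> 2 ^ k0" using large by blast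
  \<comment> \<open>The 1 pays for the factor 2 in \<open>x U + y V\<close>, \<open>h\<close> for
    the constant \<open>H\<close> (as \<open>t \<ge> 2\<close>), \<open>e\<close> for the degrees,
    and \<open>k0\<close> for the initial coefficients.\<close>
  define K where "K = 1 + h + e + k0"
  have "\<exists>U V W :: int. V \<noteq> 0 \<and> W \<noteq> 0 \<and> \<bar>U\<bar> \<le> ?t m ^ K \<and> \<bar>V\<bar> \<le> ?t m ^ K \<and> \<bar>W\<bar> \<le> ?t m ^ K \<and>
     of_int V * F m = of_int W * \<xi> - of_int U" if "m \<ge> m0" for m
    using that
  proof (induction m rule: dec_induct)
    case base
    have "(2::int) ^ k0 \<le> 2 ^ K" by (intro power_increasing) (auto simp: K_def)
    also have "\<dots> \<le> ?t m0 ^ K" by (intro power_mono t2) auto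
    finally have "\<bar>U0\<bar> + \<bar>V0\<bar> + \<bar>W0\<bar> \<le> ?t m0 ^ K" using k0 by linarith
    thus ?case using assms(4-6) by (intro exI[of _ U0] exI[of _ V0] exI[of _ W0]) auto
  next
    case (step m)
    then obtain U V W :: int where IH: "V \<noteq> 0" "W \<noteq> 0" "\<bar>U\<bar> \<le> ?t m ^ K" "\<bar>V\<bar> \<le> ?t m ^ K" "\<bar>W\<bar> \<le> ?t m ^ K"
      "of_int V * F m = of_int W * \<xi> - of_int U" by blast
    obtain x y w :: int where xyw: "x \<noteq> 0" "w \<noteq> 0" "\<bar>x\<bar> \<le> H * ?t m ^ e" "\<bar>y\<bar> \<le> H * ?t m ^ e"
      "\<bar>w\<bar> \<le> H * ?t m ^ e" "of_int x * F m = of_int y + of_int w * F (Suc m)"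
      using steps[OF \<open>m0 \<le> m\<close>] by blast
    have Ht: "H * ?t m ^ e \<le> ?t m ^ (h + e)"
    proof -
      have "H \<le> ?t m ^ h" using h power_mono[OF t2, of h m] by linarith
      thus ?thesis unfolding power_add by (intro mult_right_mono) auto
    qed
    have K2: "2 * (?t m ^ (h + e) * ?t m ^ K) \<le> ?t (Suc m) ^ K"
    proof -
      have "2 * (?t m ^ (h + e) * ?t m ^ K) \<le> ?t m ^ 1 * ?t m ^ (h + e + K)"
        unfolding power_add[of _ "h + e"] using t2[of m] by (intro mult_mono) auto
      also have "\<dots> = ?t m ^ (1 + (h + e + K))" by (simp only: power_add)
      also have "\<dots> \<le> ?t m ^ (d * K)"
      proof (rule power_increasing)
        have "1 + (h + e + K) \<le> 2 * K" by (simp add: K_def)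
        also have "\<dots> \<le> d * K" using d by (intro mult_right_mono) auto
        finally show "1 + (h + e + K) \<le> d * K" .
      qed (use t2[of m] in auto)
      also have "\<dots> = ?t (Suc m) ^ K" by (simp add: power_mult[symmetric] mult_ac)
      finally show ?thesis .
    qed
    have prod: "\<bar>u * v\<bar> \<le> ?t m ^ (h + e) * ?t m ^ K" if "\<bar>u\<bar> \<le> H * ?t m ^ e" "\<bar>v\<bar> \<le> ?t m ^ K" for u v :: int
      unfolding abs_mult using that Ht by (intro mult_mono) auto
    have nn: "0 \<le> ?t m ^ (h + e) * ?t m ^ K" by simp
    show ?case
    proof (intro exI conjI)
      show "V * w \<noteq> 0" "x * W \<noteq> 0" using IH xyw by auto
      show "\<bar>x * U + y * V\<bar> \<le> ?t (Suc m) ^ K"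
        using prod[OF xyw(3) IH(3)] prod[OF xyw(4) IH(4)] K2 by linarith
      show "\<bar>V * w\<bar> \<le> ?t (Suc m) ^ K" using prod[OF xyw(5) IH(4)] K2 nn by (simp only: mult.commute)
      show "\<bar>x * W\<bar> \<le> ?t (Suc m) ^ K" using prod[OF xyw(3) IH(5)] K2 nn by linarith
      have "of_int (V * w) * F (Suc m) = of_int V * (of_int x * F m - of_int y)"
        using xyw(6) by simp
      also have "\<dots> = of_int x * (of_int V * F m) - of_int V * of_int y" by (simp add: algebra_simps)
      finally show "of_int (V * w) * F (Suc m) = of_int (x * W) * \<xi> - of_int (x * U + y * V)"
        unfolding IH(6) by (simp add: algebra_simps)
    qed
  qed
  thus ?thesis unfolding affine_orbit_def by blast
qed

text \<open>From \<open>m0\<close> on, \<open>1/t\<close> is closer to 0 than any positive zero of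
  \<open>B\<close> or \<open>D\<close>, so the equation holds there and can be multiplied by
  \<open>t ^ e\<close>. Nonvanishing of \<open>C\<close> on the orbit gives
  \<open>w \<noteq> 0\<close>.\<close>

lemma mahler_integer_steps:
  assumes f: "conv_unit_disc f" and b: "b \<ge> 2" and d: "d \<ge> 2" and eq: "mahler_equation d f A B C D"
    and BD: "B \<noteq> 0" "D \<noteq> 0" and C: "\<And>m. ipoly C (1 / real b ^ d ^ m) \<noteq> 0"
  obtains m0 H e where "\<And>m. m \<ge> m0 \<Longrightarrow> \<exists>x y w :: int. x \<noteq> 0 \<and> w \<noteq> 0 \<and> \<bar>x\<bar> \<le> H * (int b ^ d ^ m) ^ e \<and>
        \<bar>y\<bar> \<le> H * (int b ^ d ^ m) ^ e \<and> \<bar>w\<bar> \<le> H * (int b ^ d ^ m) ^ e \<and>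
        of_int x * ieval f (1 / real b ^ d ^ m) = of_int y + of_int w * ieval f (1 / real b ^ d ^ Suc m)"
proof -
  obtain \<delta>1 where \<delta>1: "\<delta>1 > 0" "\<And>x. 0 < x \<Longrightarrow> x < \<delta>1 \<Longrightarrow> ipoly B x \<noteq> 0"
    using eventually_ipoly_nonzero_at_0[OF BD(1)] by metis
  obtain \<delta>2 where \<delta>2: "\<delta>2 > 0" "\<And>x. 0 < x \<Longrightarrow> x < \<delta>2 \<Longrightarrow> ipoly D x \<noteq> 0"
    using eventually_ipoly_nonzero_at_0[OF BD(2)] by metis
  obtain m0 where m0: "inverse (min \<delta>1 \<delta>2) < 2 ^ m0"
    using real_arch_pow[of 2 "inverse (min \<delta>1 \<delta>2)"] by auto
  define e where "e = degree (B * D) + degree (A * D) + degree (C * B)"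
  define L where "L = (\<lambda>p. \<Sum>i\<le>degree p. \<bar>coeff p i :: int\<bar>)"
  have L0: "L p \<ge> 0" for p unfolding L_def by (intro sum_nonneg) auto
  define H where "H = L (B * D) + L (A * D) + L (C * B)"
  show ?thesis
  proof (rule that[of m0 H e])
    fix m assume m: "m \<ge> m0"
    define t where "t = int b ^ d ^ m"
    define z where "z = 1 / real b ^ d ^ m"
    have z: "z = 1 / of_int t" by (simp add: z_def t_def)
    have "m < 2 ^ m" by (rule less_exp)
    also have "(2::nat) ^ m \<le> d ^ m" using d by (intro power_mono) auto
    finally have "(2::real) ^ m0 \<le> 2 ^ d ^ m" using m by (intro power_increasing) auto
    also have "\<dots> \<le> real b ^ d ^ m" using b by (intro power_mono) auto
    finally have big: "2 ^ m0 \<le> real b ^ d ^ m" .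
    have "inverse (2 ^ m0) < inverse (inverse (min \<delta>1 \<delta>2))"
      using m0 \<delta>1 \<delta>2 by (intro less_imp_inverse_less) auto
    moreover have "inverse (real b ^ d ^ m) \<le> inverse (2 ^ m0)" using big by (intro le_imp_inverse_le) auto
    ultimately have zs: "0 < z" "z < min \<delta>1 \<delta>2"
      using b by (auto simp: z_def inverse_eq_divide)
    have "(1::real) < 2 ^ d ^ m" using d by (intro one_less_power) auto
    also have "(2::real) ^ d ^ m \<le> real b ^ d ^ m" using b by (intro power_mono) auto
    finally have z1: "\<bar>z\<bar> < 1" using zs by (simp add: z_def)
    have t1: "t \<ge> 1" using b by (simp add: t_def)
    have Bz: "ipoly B z \<noteq> 0" and Dz: "ipoly D z \<noteq> 0" and Cz: "ipoly C z \<noteq> 0"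
      using \<delta>1 \<delta>2 zs C by (auto simp: z_def)
    have zd: "z ^ d = 1 / real b ^ d ^ Suc m"
      by (simp add: z_def power_one_over power_mult[symmetric] mult.commute)
    have int: "\<exists>k::int. of_int k = of_int t ^ e * ipoly p z \<and> \<bar>k\<bar> \<le> L p * t ^ e" if "degree p \<le> e" for p
      using ipoly_integral_multiple[OF that t1] unfolding z L_def .
    obtain x :: int where x: "of_int x = of_int t ^ e * ipoly (B * D) z" "\<bar>x\<bar> \<le> L (B * D) * t ^ e"
      using int[of "B * D"] by (auto simp: e_def)
    obtain y :: int where y: "of_int y = of_int t ^ e * ipoly (A * D) z" "\<bar>y\<bar> \<le> L (A * D) * t ^ e"
      using int[of "A * D"] by (auto simp: e_def)
    obtain w :: int where w: "of_int w = of_int t ^ e * ipoly (C * B) z" "\<bar>w\<bar> \<le> L (C * B) * t ^ e"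
      using int[of "C * B"] by (auto simp: e_def)
    have HL: "L p * t ^ e \<le> H * t ^ e" if "L p \<le> H" for p
      using that t1 by (intro mult_right_mono) auto
    have "of_int x * ieval f z = of_int t ^ e * (ipoly (B * D) z * ieval f z)" by (simp add: x)
    also have "\<dots> = of_int y + of_int w * ieval f (z ^ d)"
      unfolding mahler_equation_cleared[OF eq z1 Bz Dz] by (simp add: y w algebra_simps)
    finally have "of_int x * ieval f z = of_int y + of_int w * ieval f (1 / real b ^ d ^ Suc m)"
      unfolding zd .
    moreover have "real_of_int x \<noteq> 0" "real_of_int w \<noteq> 0" using Bz Cz Dz t1 by (auto simp: x w ipoly_mult)
    moreover have "\<bar>x\<bar> \<le> H * t ^ e" "\<bar>y\<bar> \<le> H * t ^ e" "\<bar>w\<bar> \<le> H * t ^ e"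
      using x(2) y(2) w(2) HL[of "B * D"] HL[of "A * D"] HL[of "C * B"] L0[of "B * D"] L0[of "A * D"] L0[of "C * B"]
      unfolding H_def by linarith+
    ultimately show "\<exists>x y w :: int. x \<noteq> 0 \<and> w \<noteq> 0 \<and> \<bar>x\<bar> \<le> H * (int b ^ d ^ m) ^ e \<and>
        \<bar>y\<bar> \<le> H * (int b ^ d ^ m) ^ e \<and> \<bar>w\<bar> \<le> H * (int b ^ d ^ m) ^ e \<and>
        of_int x * ieval f (1 / real b ^ d ^ m) = of_int y + of_int w * ieval f (1 / real b ^ d ^ Suc m)"
      unfolding t_def z_def by (intro exI[of _ x] exI[of _ y] exI[of _ w]) auto
  qed
qed

section \<open>Linear forms along the orbit\<close>

lemma eventually_const_le_orbit:
  assumes "b \<ge> 2" "d \<ge> 2"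
  shows "eventually (\<lambda>m. x \<le> real b ^ d ^ m) sequentially"
proof -
  obtain k where k: "x < 2 ^ k" using real_arch_pow[of 2 x] by auto
  have "x \<le> real b ^ d ^ m" if "m \<ge> k" for m
  proof -
    have "m < 2 ^ m" by (rule less_exp)
    also have "(2::nat) ^ m \<le> d ^ m" using assms by (intro power_mono) auto
    finally have "(2::real) ^ k \<le> 2 ^ d ^ m" using that by (intro power_increasing) auto
    also have "\<dots> \<le> real b ^ d ^ m" using assms by (intro power_mono) auto
    finally show ?thesis using k by linarith
  qed
  thus ?thesis by (auto simp: eventually_sequentially)
qed

text \<open>The Pade form at \<open>1/t\<close>, multiplied by \<open>t ^ n\<close>, is an integer
  form in 1 and \<open>f(1/t)\<close>; the orbit relation replaces \<open>f(1/t)\<close> by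
  \<open>\<xi>\<close> at the price of \<open>t ^ K\<close>. All constants are absorbed in one more
  factor \<open>t\<close>.\<close>

lemma pade_linear_forms:
  assumes b: "b \<ge> 2" and d: "d \<ge> 2" and f: "conv_unit_disc (Abs_fps c)"
    and n: "n < n'" and H: "hankel_det c n' \<noteq> 0"
    and K: "\<And>m. m \<ge> m0 \<Longrightarrow> \<exists>U V W :: int. V \<noteq> 0 \<and> W \<noteq> 0 \<and>
     \<bar>U\<bar> \<le> (int b ^ d ^ m) ^ K \<and> \<bar>V\<bar> \<le> (int b ^ d ^ m) ^ K \<and> \<bar>W\<bar> \<le> (int b ^ d ^ m) ^ K \<and>
     of_int V * ieval (Abs_fps c) (1 / real b ^ d ^ m) = of_int W * \<xi> - of_int U"
  shows "\<exists>M. \<forall>m\<ge>M. \<exists>p q :: int. \<bar>real_of_int q\<bar> \<le> (real b ^ d ^ m) ^ (n + K + 1) \<and>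
     1 \<le> (real b ^ d ^ m) ^ n' * \<bar>real_of_int q * \<xi> - real_of_int p\<bar> \<and>
     (real b ^ d ^ m) ^ n * \<bar>real_of_int q * \<xi> - real_of_int p\<bar> \<le> (real b ^ d ^ m) ^ (K + 1)"
proof -
  obtain P Q h where PQ: "degree Q \<le> n" "degree P \<le> n" and h: "2 * n \<le> h" "h < n + n'"
    and lead: "fps_nth (fps_of_poly Q * Abs_fps c - fps_of_poly P) h \<noteq> 0"
    "\<And>j. j < h \<Longrightarrow> fps_nth (fps_of_poly Q * Abs_fps c - fps_of_poly P) j = 0"
    using pade_form[OF n H] by metis
  define g where "g = fps_of_poly Q * Abs_fps c - fps_of_poly P"
  have g_eq: "g = fps_of_poly Q * Abs_fps c + fps_of_poly (- P)"
    by (simp add: g_def fps_of_poly_uminus)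
  have g: "conv_unit_disc g" unfolding g_eq by (intro conv_unit_disc_add conv_unit_disc_mult conv_unit_disc_poly f)
  have evg: "ieval g z = ipoly Q z * ieval (Abs_fps c) z - ipoly P z" if "\<bar>z\<bar> < 1" for z :: real
  proof -
    have "ieval g z = ipoly Q z * ieval (Abs_fps c) z + ipoly (- P) z"
      unfolding g_eq using that by (simp add: ieval_add ieval_mult conv_unit_disc_mult conv_unit_disc_poly f ipoly_conv_ieval)
    thus ?thesis by (simp add: ipoly_altdef sum_negf)
  qed
  obtain c0 C0 \<delta> :: real where c0: "c0 > 0" "\<delta> > 0"
    and bounds: "\<And>z::real. 0 < z \<Longrightarrow> z < \<delta> \<Longrightarrow> c0 * z ^ h \<le> \<bar>ieval g z\<bar> \<and> \<bar>ieval g z\<bar> \<le> C0 * z ^ h"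
    using ieval_leading_term[OF g lead[folded g_def]] by metis
  define L where "L = real_of_int (\<Sum>i\<le>degree Q. \<bar>coeff Q i\<bar>)"
  have "eventually (\<lambda>m. max (max L (1 / c0)) (max C0 (2 / \<delta>)) \<le> real b ^ d ^ m \<and> m \<ge> m0) sequentially"
    by (intro eventually_conj eventually_const_le_orbit[OF b d] eventually_ge_at_top)
  then obtain M where M: "\<And>m. m \<ge> M \<Longrightarrow> max (max L (1 / c0)) (max C0 (2 / \<delta>)) \<le> real b ^ d ^ m \<and> m \<ge> m0"
    unfolding eventually_sequentially by blast
  show ?thesis
  proof (intro exI[of _ M] allI impI)
    fix m assume "m \<ge> M"
    define t where "t = real b ^ d ^ m"
    define ti where "ti = int b ^ d ^ m"
    have tt: "of_int ti = t" by (simp add: t_def ti_def)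
    have tb: "L \<le> t" "1 / c0 \<le> t" "C0 \<le> t" "2 / \<delta> \<le> t" "m \<ge> m0"
      using M[OF \<open>m \<ge> M\<close>] by (auto simp: t_def)
    have "(2::real) ^ 1 \<le> real b ^ d ^ m" using b d
      by (intro order_trans[OF power_increasing[of 1 "d ^ m" "2::real"] power_mono]) auto
    hence t2: "t \<ge> 2" by (simp add: t_def)
    have ti1: "ti \<ge> 1" using b by (simp add: ti_def)
    define z where "z = 1 / t"
    have z: "0 < z" "z < \<delta>" "\<bar>z\<bar> < 1"
      using t2 tb(4) c0(2) by (auto simp: z_def field_simps)
    obtain q0 :: int where q0: "of_int q0 = t ^ n * ipoly Q z" "\<bar>q0\<bar> \<le> (\<Sum>i\<le>degree Q. \<bar>coeff Q i\<bar>) * ti ^ n"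
      using ipoly_integral_multiple[OF PQ(1) ti1] unfolding tt z_def by blast
    obtain p0 :: int where p0: "of_int p0 = t ^ n * ipoly P z"
      using ipoly_integral_multiple[OF PQ(2) ti1] unfolding tt z_def by blast
    obtain U V W :: int where UVW: "V \<noteq> 0" "W \<noteq> 0" "\<bar>V\<bar> \<le> ti ^ K" "\<bar>W\<bar> \<le> ti ^ K"
      "of_int V * ieval (Abs_fps c) z = of_int W * \<xi> - of_int U"
      using K[OF tb(5)] unfolding ti_def[symmetric] t_def[symmetric] z_def[symmetric] by blast
    have to_real: "\<bar>real_of_int x\<bar> \<le> t ^ k" if "\<bar>x\<bar> \<le> ti ^ k" for x k
    proof -
      have "real_of_int \<bar>x\<bar> \<le> real_of_int (ti ^ k)" using that by (simp only: of_int_le_iff)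
      thus ?thesis by (simp add: tt)
    qed
    \<comment> \<open>Multiplying \<open>q0 f(1/t) - p0\<close> by \<open>V\<close> and inserting
      \<open>V f(1/t) = W \<xi> - U\<close> gives these coefficients.\<close>
    define q where "q = q0 * W"
    define p where "p = q0 * U + p0 * V"
    have qb: "\<bar>real_of_int q\<bar> \<le> t ^ (n + K + 1)"
    proof -
      have "real_of_int \<bar>q0\<bar> \<le> real_of_int ((\<Sum>i\<le>degree Q. \<bar>coeff Q i\<bar>) * ti ^ n)"
        using q0(2) by (simp only: of_int_le_iff)
      hence "\<bar>real_of_int q0\<bar> \<le> L * t ^ n" by (simp only: L_def of_int_mult of_int_power tt of_int_abs)
      also have "\<dots> \<le> t * t ^ n" using tb(1) t2 by (intro mult_right_mono) auto
      finally have "\<bar>real_of_int q0\<bar> \<le> t * t ^ n" .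
      hence "\<bar>real_of_int q0\<bar> * \<bar>real_of_int W\<bar> \<le> (t * t ^ n) * t ^ K"
        using to_real[OF UVW(4)] t2 by (intro mult_mono) auto
      thus ?thesis by (simp add: q_def abs_mult power_add mult_ac)
    qed
    have form: "of_int q * \<xi> - of_int p = of_int V * (t ^ n * ieval g z)"
    proof -
      have "of_int q * \<xi> - of_int p = of_int q0 * (of_int W * \<xi> - of_int U) - of_int p0 * of_int V"
        by (simp add: q_def p_def algebra_simps)
      also have "\<dots> = of_int V * (t ^ n * ieval g z)"
        unfolding UVW(5)[symmetric] q0 p0 evg[OF z(3)] by (simp add: algebra_simps)
      finally show ?thesis .
    qed
    have V1: "1 \<le> \<bar>real_of_int V\<bar>" using UVW(1) by linarith
    have zt: "z ^ h * t ^ h = 1" using t2 by (simp add: z_def power_one_over)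
    have lower: "1 \<le> t ^ n' * \<bar>of_int q * \<xi> - of_int p\<bar>"
    proof -
      have "1 = z ^ h * t ^ h" by (simp add: zt)
      \<comment> \<open>As \<open>h \<le> n + n' - 1\<close>, one factor of
        \<open>t ^ (n + n')\<close> is spare; it outweighs \<open>1 / c0\<close>.\<close>
      also have "\<dots> \<le> z ^ h * t ^ (n' + n - 1)"
        using h t2 z by (intro mult_left_mono power_increasing) auto
      also have "\<dots> \<le> (c0 * t) * (z ^ h * t ^ (n' + n - 1))"
      proof -
        have "1 \<le> c0 * t" using tb(2) c0(1) by (simp add: field_simps)
        thus ?thesis using z t2 mult_right_mono[of 1 "c0 * t" "z ^ h * t ^ (n' + n - 1)"] by simp
      qed
      also have "\<dots> = c0 * z ^ h * t ^ Suc (n' + n - 1)" by simp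
      also have "\<dots> = (c0 * z ^ h) * (t ^ n' * t ^ n)" using n by (simp add: power_add[symmetric])
      also have "\<dots> \<le> \<bar>ieval g z\<bar> * (t ^ n' * t ^ n)"
        using bounds[OF z(1,2)] t2 by (intro mult_right_mono) auto
      also have "\<dots> \<le> \<bar>real_of_int V\<bar> * (\<bar>ieval g z\<bar> * (t ^ n' * t ^ n))"
        using V1 t2 mult_right_mono[of 1 "\<bar>real_of_int V\<bar>" "\<bar>ieval g z\<bar> * (t ^ n' * t ^ n)"] by simp
      also have "\<dots> = t ^ n' * \<bar>of_int q * \<xi> - of_int p\<bar>"
        unfolding form using t2 by (simp add: abs_mult mult_ac)
      finally show ?thesis .
    qed
    have upper: "t ^ n * \<bar>of_int q * \<xi> - of_int p\<bar> \<le> t ^ (K + 1)"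
    proof -
      have "t ^ n * \<bar>of_int q * \<xi> - of_int p\<bar> = \<bar>real_of_int V\<bar> * (t ^ (2 * n) * \<bar>ieval g z\<bar>)"
      proof -
        have "t ^ (2 * n) = t ^ n * t ^ n" by (simp only: mult_2 power_add)
        thus ?thesis unfolding form using t2 by (simp only: abs_mult power_abs) simp
      qed
      also have "\<dots> \<le> t ^ K * (t ^ h * (t * z ^ h))"
      proof (intro mult_mono to_real UVW)
        show "t ^ (2 * n) \<le> t ^ h" using h t2 by (intro power_increasing) auto
        have "\<bar>ieval g z\<bar> \<le> C0 * z ^ h" using bounds[OF z(1,2)] by blast
        also have "\<dots> \<le> t * z ^ h" using tb(3) z by (intro mult_right_mono) auto
        finally show "\<bar>ieval g z\<bar> \<le> t * z ^ h" .
      qed (use t2 in auto)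
      also have "\<dots> = t ^ (K + 1) * (z ^ h * t ^ h)" by (simp add: mult_ac)
      finally show ?thesis by (simp add: zt)
    qed
    show "\<exists>p q :: int. \<bar>real_of_int q\<bar> \<le> (real b ^ d ^ m) ^ (n + K + 1) \<and>
     1 \<le> (real b ^ d ^ m) ^ n' * \<bar>real_of_int q * \<xi> - real_of_int p\<bar> \<and>
     (real b ^ d ^ m) ^ n * \<bar>real_of_int q * \<xi> - real_of_int p\<bar> \<le> (real b ^ d ^ m) ^ (K + 1)"
      using qb lower upper unfolding t_def by blast
  qed
qed

text \<open>A scale above \<open>N i\<close> and up to \<open>N (i + 1)\<close> is served by the
  Pade form of degree \<open>n (i + 1)\<close>, whose lower bound involves \<open>n (i + 2)\<close>:
  hence two steps of the sequence. The shift \<open>a\<close> will hold the loss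
  \<open>K + 1\<close>.\<close>

lemma ratio_tendsto_1_gap:
  fixes n :: "nat \<Rightarrow> nat" and a \<epsilon> :: real
  assumes mono: "strict_mono n" and ratio: "(\<lambda>i. real (n (Suc i)) / real (n i)) \<longlonglongrightarrow> 1" and \<epsilon>: "\<epsilon> > 0"
  shows "\<exists>I. \<forall>i\<ge>I. real (n i) > a \<and> real (n (Suc (Suc i))) + a \<le> (1 + \<epsilon>) * (real (n i) - a)"
proof -
  have lim: "filterlim (\<lambda>i. real (n i)) at_top sequentially"
    using filterlim_compose[OF filterlim_real_sequentially filterlim_subseq[OF mono]] .
  have small: "(\<lambda>i. a / real (n i)) \<longlonglongrightarrow> 0"
    by (intro tendsto_divide_0[OF tendsto_const] filterlim_at_top_imp_at_infinity lim)
  have ratio2: "(\<lambda>i. real (n (Suc (Suc i))) / real (n (Suc i))) \<longlonglongrightarrow> 1"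
    using LIMSEQ_Suc[OF ratio] .
  have "(\<lambda>i. real (n (Suc (Suc i))) / real (n (Suc i)) * (real (n (Suc i)) / real (n i)) + a / real (n i)
      - (1 + \<epsilon>) * (1 - a / real (n i))) \<longlonglongrightarrow> 1 * 1 + 0 - (1 + \<epsilon>) * (1 - 0)"
    by (intro tendsto_intros ratio ratio2 small)
  hence "eventually (\<lambda>i. real (n (Suc (Suc i))) / real (n (Suc i)) * (real (n (Suc i)) / real (n i)) + a / real (n i)
      - (1 + \<epsilon>) * (1 - a / real (n i)) < 0) sequentially"
    by (rule order_tendstoD) (use \<epsilon> in auto)
  moreover have "eventually (\<lambda>i. real (n i) > max a 0) sequentially"
    using lim unfolding filterlim_at_top_dense by blast
  ultimately have "eventually (\<lambda>i. real (n i) > a \<and> real (n (Suc (Suc i))) + a \<le> (1 + \<epsilon>) * (real (n i) - a)) sequentially"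
  proof eventually_elim
    case (elim i)
    have pos: "real (n i) > 0" using elim(2) by simp
    have "n i < n (Suc i)" using mono by (simp add: strict_mono_Suc_iff)
    hence "real (n (Suc i)) > 0" by simp
    hence "real (n (Suc (Suc i))) / real (n i) + a / real (n i) - (1 + \<epsilon>) * (1 - a / real (n i)) < 0"
      using elim(1) by simp
    hence "(real (n (Suc (Suc i))) / real (n i) + a / real (n i) - (1 + \<epsilon>) * (1 - a / real (n i))) * real (n i) < 0"
      using pos by (simp add: mult_less_0_iff)
    moreover have "(x / u + a / u - (1 + \<epsilon>) * (1 - a / u)) * u = x + a - (1 + \<epsilon>) * (u - a)"
      if "u > 0" for x u :: real using that by (simp add: field_simps)
    ultimately have "real (n (Suc (Suc i))) + a - (1 + \<epsilon>) * (real (n i) - a) < 0"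
      using pos by metis
    thus ?case using elim(2) by auto
  qed
  thus ?thesis by (simp add: eventually_sequentially)
qed

text \<open>The scales \<open>n\<^sub>i d\<^sup>m\<close> with \<open>i\<close> in a finite range and \<open>m\<close> arbitrary form a set of ratio-dense
  logarithmic sizes.\<close>
lemma scale_selection:
  fixes N :: "nat \<Rightarrow> real" and d :: nat
  assumes d: "d \<ge> 2" and pos: "\<And>i. i \<ge> I \<Longrightarrow> N i > 0" and unb: "\<exists>J\<ge>I. N J \<ge> real d * N I"
  obtains J where "\<And>M T. T > N I * real d ^ M \<Longrightarrow>
    \<exists>m i. m \<ge> M \<and> I \<le> i \<and> i \<le> J \<and> N i * real d ^ m < T \<and> T \<le> N (Suc i) * real d ^ m"
proof -
  obtain J where J: "J \<ge> I" "N J \<ge> real d * N I" using unb by blast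
  show ?thesis
  proof (rule that[of J])
    fix M T assume T: "T > N I * real d ^ M"
    have NI: "N I > 0" using pos by simp
    obtain k where "T / N I < real d ^ k" using real_arch_pow[of "real d"] d by (metis of_nat_1 of_nat_less_iff Suc_1 less_eq_Suc_le)
    hence ex: "T \<le> N I * real d ^ k" using NI by (simp add: field_simps)
    \<comment> \<open>Minimality puts \<open>T\<close> above \<open>N I * d ^ m\<close> and at most
      \<open>N I * d ^ (m + 1)\<close>, where \<open>k0 = m + 1\<close>; the latter is at most
      \<open>N J * d ^ m\<close>. So some step of the sequence between \<open>I\<close> and
      \<open>J\<close> encloses \<open>T\<close>.\<close>
    define k0 where "k0 = (LEAST k. T \<le> N I * real d ^ k)"
    have k0: "T \<le> N I * real d ^ k0" unfolding k0_def by (rule LeastI) (rule ex)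
    have "k0 > M"
    proof (rule ccontr)
      assume "\<not> ?thesis"
      hence "N I * real d ^ k0 \<le> N I * real d ^ M" using NI d by (intro mult_left_mono power_increasing) auto
      thus False using T k0 by linarith
    qed
    then obtain m where m: "k0 = Suc m" "m \<ge> M" by (cases k0) auto
    have lowT: "N I * real d ^ m < T"
      using not_less_Least[of m "\<lambda>k. T \<le> N I * real d ^ k"] m unfolding k0_def[symmetric] by simp
    have "T \<le> real d * N I * real d ^ m" using k0 by (simp add: m mult_ac)
    also have "\<dots> \<le> N J * real d ^ m" using J by (intro mult_right_mono) auto
    finally have TJ: "I \<le> J \<and> T \<le> N J * real d ^ m" using J by simp
    define i0 where "i0 = (LEAST i. I \<le> i \<and> T \<le> N i * real d ^ m)"
    have i0: "I \<le> i0" "T \<le> N i0 * real d ^ m" using LeastI[of "\<lambda>i. I \<le> i \<and> T \<le> N i * real d ^ m" J, OF TJ] unfolding i0_def by auto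
    have "i0 \<le> J" unfolding i0_def by (rule Least_le) (rule TJ)
    have "i0 \<noteq> I" using i0 lowT by auto
    then obtain i where i: "i0 = Suc i" "I \<le> i" using i0(1) by (cases i0) auto
    have "N i * real d ^ m < T"
      using not_less_Least[of i "\<lambda>i. I \<le> i \<and> T \<le> N i * real d ^ m"] i unfolding i0_def[symmetric] by auto
    thus "\<exists>m i. m \<ge> M \<and> I \<le> i \<and> i \<le> J \<and> N i * real d ^ m < T \<and> T \<le> N (Suc i) * real d ^ m"
      using m i i0 \<open>i0 \<le> J\<close> by (intro exI[of _ m] exI[of _ i]) auto
  qed
qed

lemma affine_orbit_dense_linear_forms:
  assumes b: "b \<ge> 2" and d: "d \<ge> 2" and f: "conv_unit_disc (Abs_fps c)"
    and mono: "strict_mono n" and H: "\<And>i. hankel_det c (n i) \<noteq> 0"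
    and ratio: "(\<lambda>i. real (n (Suc i)) / real (n i)) \<longlonglongrightarrow> 1"
    and orbit: "affine_orbit b d (\<lambda>m. ieval (Abs_fps c) (1 / real b ^ d ^ m)) \<xi>"
  shows "dense_linear_forms \<xi>"
  unfolding dense_linear_forms_def
proof (intro allI impI)
  fix \<epsilon> :: real assume \<epsilon>: "\<epsilon> > 0"
  obtain K m0 where K: "\<And>m. m \<ge> m0 \<Longrightarrow> \<exists>U V W :: int. V \<noteq> 0 \<and> W \<noteq> 0 \<and>
     \<bar>U\<bar> \<le> (int b ^ d ^ m) ^ K \<and> \<bar>V\<bar> \<le> (int b ^ d ^ m) ^ K \<and> \<bar>W\<bar> \<le> (int b ^ d ^ m) ^ K \<and>
     of_int V * ieval (Abs_fps c) (1 / real b ^ d ^ m) = of_int W * \<xi> - of_int U"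
    using orbit unfolding affine_orbit_def by blast
  have "\<forall>i. \<exists>M. \<forall>m\<ge>M. \<exists>p q :: int. \<bar>real_of_int q\<bar> \<le> (real b ^ d ^ m) ^ (n i + K + 1) \<and>
     1 \<le> (real b ^ d ^ m) ^ n (Suc i) * \<bar>real_of_int q * \<xi> - real_of_int p\<bar> \<and>
     (real b ^ d ^ m) ^ n i * \<bar>real_of_int q * \<xi> - real_of_int p\<bar> \<le> (real b ^ d ^ m) ^ (K + 1)"
    using mono by (intro allI pade_linear_forms[OF b d f _ H K]) (auto simp: strict_mono_Suc_iff)
  then obtain M where M: "\<And>i m. m \<ge> M i \<Longrightarrow> \<exists>p q :: int. \<bar>real_of_int q\<bar> \<le> (real b ^ d ^ m) ^ (n i + K + 1) \<and>
     1 \<le> (real b ^ d ^ m) ^ n (Suc i) * \<bar>real_of_int q * \<xi> - real_of_int p\<bar> \<and>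
     (real b ^ d ^ m) ^ n i * \<bar>real_of_int q * \<xi> - real_of_int p\<bar> \<le> (real b ^ d ^ m) ^ (K + 1)"
    by metis
  define a where "a = real (K + 1)"
  \<comment> \<open>With \<open>a = K + 1\<close>, the form built from \<open>n i\<close> has size
    at most \<open>t\<close> to the power \<open>- N i\<close>.\<close>
  define N where "N = (\<lambda>i. real (n i) - a)"
  obtain I where I: "\<And>i. i \<ge> I \<Longrightarrow> real (n i) > a \<and> real (n (Suc (Suc i))) + a \<le> (1 + \<epsilon>) * N i"
    using ratio_tendsto_1_gap[OF mono ratio \<epsilon>, of a] unfolding N_def by blast
  have unb: "\<exists>J\<ge>I. N J \<ge> real d * N I"
  proof -
    define J where "J = max I (nat \<lceil>real d * N I + a\<rceil>)"
    have "real d * N I + a \<le> real J" unfolding J_def by linarith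
    also have "\<dots> \<le> real (n J)" using seq_suble[OF mono] by simp
    finally show ?thesis by (intro exI[of _ J]) (auto simp: N_def J_def)
  qed
  have Npos: "N i > 0" if "i \<ge> I" for i using I[OF that] by (simp add: N_def)
  obtain J where J: "\<And>M T. T > N I * real d ^ M \<Longrightarrow>
    \<exists>m i. m \<ge> M \<and> I \<le> i \<and> i \<le> J \<and> N i * real d ^ m < T \<and> T \<le> N (Suc i) * real d ^ m"
    using scale_selection[where N = N and I = I, OF d Npos unb] by metis
  \<comment> \<open>Only indices up to \<open>Suc J\<close> occur, and \<open>J\<close> was fixed
    before the scale, so one threshold in \<open>m\<close> serves all of them.\<close>
  define M' where "M' = (\<Sum>i\<le>Suc J. M i)"
  have M': "M i \<le> M'" if "i \<le> Suc J" for i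
    unfolding M'_def using that by (intro member_le_sum) auto
  show "\<exists>X0. \<forall>X\<ge>X0. \<exists>p q :: int. \<bar>real_of_int q\<bar> \<le> X powr (1 + \<epsilon>) \<and>
     X powr (- 1 - \<epsilon>) \<le> \<bar>real_of_int q * \<xi> - real_of_int p\<bar> \<and> \<bar>real_of_int q * \<xi> - real_of_int p\<bar> \<le> 1 / X"
  \<comment> \<open>The \<open>+ 1\<close> makes the inequality \<open>T > N I * d ^ M'\<close>
    strict, as the selection of the scale requires.\<close>
  proof (intro exI[of _ "real b powr (N I * real d ^ M' + 1)"] allI impI)
    fix X assume X: "X \<ge> real b powr (N I * real d ^ M' + 1)"
    have b1: "real b > 1" using b by simp
    have "real b powr (N I * real d ^ M' + 1) > 0" using b1 by simp
    hence X0: "X > 0" using X by linarith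
    define T where "T = log b X"
    have XT: "X = real b powr T" using X0 b1 by (simp add: T_def)
    have "T > N I * real d ^ M'" using X b1 unfolding XT by simp
    then obtain m i where mi: "m \<ge> M'" "I \<le> i" "i \<le> J" "N i * real d ^ m < T" "T \<le> N (Suc i) * real d ^ m"
      using J by blast
    \<comment> \<open>The form of index \<open>Suc i\<close> is used:
      \<open>T \<le> N (Suc i) * d ^ m\<close> makes it at most \<open>1 / X\<close>, and
      \<open>N i * d ^ m < T\<close> controls its coefficient and its lower bound through the gap
      estimate.\<close>
    have "m \<ge> M (Suc i)" using mi M'[of "Suc i"] by linarith
    then obtain p q :: int where pq: "\<bar>real_of_int q\<bar> \<le> (real b ^ d ^ m) ^ (n (Suc i) + K + 1)"
     "1 \<le> (real b ^ d ^ m) ^ n (Suc (Suc i)) * \<bar>q * \<xi> - p\<bar>"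
     "(real b ^ d ^ m) ^ n (Suc i) * \<bar>q * \<xi> - p\<bar> \<le> (real b ^ d ^ m) ^ (K + 1)"
      using M by blast
    define D where "D = real d ^ m"
    have D0: "D > 0" using d by (simp add: D_def)
    have pw: "(real b ^ d ^ m) ^ k = real b powr (real k * D)" for k
    proof -
      have "real b powr (real k * D) = real b powr real (k * d ^ m)" by (simp add: D_def)
      also have "\<dots> = real b ^ (k * d ^ m)" using b1 by (intro powr_realpow) simp
      finally show ?thesis by (simp add: power_mult[symmetric] mult.commute)
    qed
    have gap: "(real (n (Suc (Suc i))) + a) * D \<le> (1 + \<epsilon>) * T"
    proof -
      have "(real (n (Suc (Suc i))) + a) * D \<le> (1 + \<epsilon>) * N i * D"
        using I[OF mi(2)] D0 by (intro mult_right_mono) auto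
      also have "\<dots> = (1 + \<epsilon>) * (N i * D)" by simp
      also have "\<dots> \<le> (1 + \<epsilon>) * T" using mi(4) \<epsilon> unfolding D_def by (intro mult_left_mono) auto
      finally show ?thesis .
    qed
    have a0: "a \<ge> 0" by (simp add: a_def)
    have n_less: "n (Suc i) \<le> n (Suc (Suc i))" using mono by (simp add: strict_mono_less_eq)
    have "\<bar>real_of_int q\<bar> \<le> real b powr (real (n (Suc i) + K + 1) * D)" using pq(1) unfolding pw .
    also have "\<dots> \<le> real b powr ((1 + \<epsilon>) * T)"
    proof (rule powr_mono)
      have "real (n (Suc i) + K + 1) * D \<le> (real (n (Suc (Suc i))) + a) * D"
        using n_less D0 by (intro mult_right_mono) (auto simp: a_def)
      thus "real (n (Suc i) + K + 1) * D \<le> (1 + \<epsilon>) * T" using gap by linarith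
    qed (use b1 in auto)
    finally have q: "\<bar>real_of_int q\<bar> \<le> X powr (1 + \<epsilon>)" by (simp add: XT powr_powr mult.commute)
    have "real b powr (real (n (Suc (Suc i))) * D) \<le> real b powr ((1 + \<epsilon>) * T)"
    proof (rule powr_mono)
      have "real (n (Suc (Suc i))) * D \<le> (real (n (Suc (Suc i))) + a) * D"
        using a0 D0 by (intro mult_right_mono) auto
      thus "real (n (Suc (Suc i))) * D \<le> (1 + \<epsilon>) * T" using gap by linarith
    qed (use b1 in auto)
    hence "1 \<le> real b powr ((1 + \<epsilon>) * T) * \<bar>q * \<xi> - p\<bar>"
      using pq(2) unfolding pw by (meson abs_ge_zero mult_right_mono order_trans)
    hence "real b powr (- ((1 + \<epsilon>) * T)) * 1 \<le> real b powr (- ((1 + \<epsilon>) * T)) * (real b powr ((1 + \<epsilon>) * T) * \<bar>q * \<xi> - p\<bar>)"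
      by (intro mult_left_mono) auto
    also have "\<dots> = \<bar>q * \<xi> - p\<bar>" using b1 by (simp add: mult.assoc[symmetric] powr_add[symmetric])
    finally have low: "X powr (- 1 - \<epsilon>) \<le> \<bar>q * \<xi> - p\<bar>" by (simp add: XT powr_powr algebra_simps)
    have "X * \<bar>q * \<xi> - p\<bar> \<le> real b powr (N (Suc i) * D) * \<bar>q * \<xi> - p\<bar>"
      unfolding XT using mi(5) b1 by (intro mult_right_mono powr_mono) (auto simp: D_def)
    also have "\<dots> = real b powr (- (a * D)) * (real b powr (real (n (Suc i)) * D) * \<bar>q * \<xi> - p\<bar>)"
      by (simp add: N_def mult.assoc[symmetric] powr_add[symmetric] algebra_simps)
    also have "\<dots> \<le> real b powr (- (a * D)) * real b powr (a * D)"
      using pq(3) unfolding pw a_def by (intro mult_left_mono) auto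
    also have "\<dots> = 1" using b1 by (simp add: powr_add[symmetric])
    finally have "\<bar>q * \<xi> - p\<bar> \<le> 1 / X" using X0 by (simp add: field_simps)
    thus "\<exists>p q :: int. \<bar>real_of_int q\<bar> \<le> X powr (1 + \<epsilon>) \<and>
     X powr (- 1 - \<epsilon>) \<le> \<bar>real_of_int q * \<xi> - real_of_int p\<bar> \<and> \<bar>real_of_int q * \<xi> - real_of_int p\<bar> \<le> 1 / X"
      using q low by blast
  qed
qed

section \<open>Transcendence\<close>

lemma sum_div_mod_eq:
  fixes F :: "nat \<Rightarrow> nat \<Rightarrow> nat \<Rightarrow> 'a::comm_monoid_add"
  assumes "S > 0"
  shows "(\<Sum>k<S * S. F k (k div S) (k mod S)) = (\<Sum>j<S. \<Sum>r<S. F (j * S + r) j r)"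
proof -
  have "(\<Sum>k<S * S. F k (k div S) (k mod S)) = (\<Sum>j<S. \<Sum>k\<in>{j * S..<j * S + S}. F k (k div S) (k mod S))"
    by (rule sum.nat_group[symmetric])
  also have "\<dots> = (\<Sum>j<S. \<Sum>r<S. F (j * S + r) j r)"
  proof (rule sum.cong[OF refl])
    fix j
    have "(\<Sum>k\<in>{j * S..<j * S + S}. F k (k div S) (k mod S))
        = (\<Sum>r\<in>{0..<S}. F (r + j * S) ((r + j * S) div S) ((r + j * S) mod S))"
      using sum.shift_bounds_nat_ivl[of "\<lambda>k. F k (k div S) (k mod S)" 0 "j * S" S] by (simp add: add.commute)
    also have "\<dots> = (\<Sum>r<S. F (j * S + r) j r)"
      using assms by (intro sum.cong) (auto simp: add.commute)
    finally show "(\<Sum>k\<in>{j * S..<j * S + S}. F k (k div S) (k mod S)) = (\<Sum>r<S. F (j * S + r) j r)" .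
  qed
  finally show ?thesis .
qed

text \<open>There are \<open>(N + 1)\<^sup>2\<close> unknown coefficients against
  \<open>N\<^sup>2\<close> conditions. The coefficient of the \<open>r\<close>-th power of the
  variable in \<open>P j\<close> has index \<open>j * S + r\<close>, which \<open>div\<close> and
  \<open>mod\<close> decode.\<close>

lemma auxiliary_form:
  fixes f :: "int fps"
  obtains P :: "nat \<Rightarrow> int poly" where "\<And>j. degree (P j) \<le> N" "\<exists>j\<le>N. P j \<noteq> 0"
    "\<And>i. i < N ^ 2 \<Longrightarrow> fps_nth (\<Sum>j\<le>N. fps_of_poly (P j) * f ^ j) i = 0"
proof -
  define S where "S = Suc N"
  have S: "S > 0" by (simp add: S_def)
  have "N ^ 2 < S * S" by (simp add: S_def power2_eq_square)
  then obtain v :: "nat \<Rightarrow> int" where v: "\<exists>k<S * S. v k \<noteq> 0"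
    "\<And>i. i < N ^ 2 \<Longrightarrow> (\<Sum>k<S * S. fps_nth (fps_X ^ (k mod S) * f ^ (k div S)) i * v k) = 0"
    using underdetermined_int_system[of "N ^ 2" "S * S" "\<lambda>i k. fps_nth (fps_X ^ (k mod S) * f ^ (k div S)) i"]
    by blast
  define P where "P = (\<lambda>j. \<Sum>r<S. monom (v (j * S + r)) r)"
  show ?thesis
  proof (rule that[of P])
    show "degree (P j) \<le> N" for j
      using degree_sum_monom_less[OF S] by (simp add: P_def S_def less_Suc_eq_le)
    obtain k where k: "k < S * S" "v k \<noteq> 0" using v(1) by blast
    have "coeff (P (k div S)) (k mod S) = v k" using S by (simp add: P_def coeff_sum_monom)
    moreover have "k div S < S" using k(1) by (simp add: less_mult_imp_div_less)
    ultimately show "\<exists>j\<le>N. P j \<noteq> 0" using k(2) by (intro exI[of _ "k div S"]) (auto simp: S_def)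
    fix i assume i: "i < N ^ 2"
    have "(\<Sum>j\<le>N. fps_of_poly (P j) * f ^ j) = (\<Sum>j<S. \<Sum>r<S. fps_const (v (j * S + r)) * (fps_X ^ r * f ^ j))"
      by (simp add: P_def S_def lessThan_Suc_atMost fps_of_poly_sum fps_of_poly_monom sum_distrib_right mult.assoc
          del: sum.lessThan_Suc sum.atMost_Suc)
    also have "\<dots> = (\<Sum>k<S * S. fps_const (v k) * (fps_X ^ (k mod S) * f ^ (k div S)))"
      by (rule sum_div_mod_eq[OF S, symmetric])
    finally have "fps_nth (\<Sum>j\<le>N. fps_of_poly (P j) * f ^ j) i
        = (\<Sum>k<S * S. v k * fps_nth (fps_X ^ (k mod S) * f ^ (k div S)) i)"
      by (simp add: fps_sum_nth)
    thus "fps_nth (\<Sum>j\<le>N. fps_of_poly (P j) * f ^ j) i = 0" using v(2)[OF i] by (simp add: mult.commute)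
  qed
qed

text \<open>After multiplication by \<open>V ^ N\<close> the powers of
  \<open>V F = W \<xi> - U\<close> are expanded binomially. Each term carries \<open>N - j\<close>
  factors \<open>V\<close>, \<open>i\<close> factors \<open>W\<close> and \<open>j - i\<close>
  factors \<open>U\<close>, that is \<open>N\<close> factors in all.\<close>

lemma affine_power_expansion:
  fixes \<xi> :: real and p :: "nat \<Rightarrow> int" and U V W T L :: int
  assumes bd: "\<bar>U\<bar> \<le> T" "\<bar>V\<bar> \<le> T" "\<bar>W\<bar> \<le> T" "\<And>j. j \<le> N \<Longrightarrow> \<bar>p j\<bar> \<le> L"
    and F: "of_int V * F = of_int W * \<xi> - of_int U"
  shows "\<exists>r :: nat \<Rightarrow> int. of_int V ^ N * (\<Sum>j\<le>N. of_int (p j) * F ^ j) = (\<Sum>i\<le>N. of_int (r i) * \<xi> ^ i) \<and>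
      (\<forall>i\<le>N. \<bar>r i\<bar> \<le> int (Suc N) * 2 ^ N * L * T ^ N)"
proof (intro exI conjI allI impI)
  \<comment> \<open>For \<open>i > j\<close> the binomial coefficient is zero, so the truncated
    difference \<open>j - i\<close> does no harm.\<close>
  define r where "r = (\<lambda>i. \<Sum>j\<le>N. p j * V ^ (N - j) * (int (j choose i) * W ^ i * (- U) ^ (j - i)))"
  have "of_int V ^ N * (\<Sum>j\<le>N. of_int (p j) * F ^ j)
      = (\<Sum>j\<le>N. of_int (p j) * of_int V ^ (N - j) * (of_int V * F) ^ j)"
  proof -
    have "of_int V ^ N = (of_int V ^ (N - j) * of_int V ^ j :: real)" if "j \<le> N" for j
      using that by (simp flip: power_add)
    thus ?thesis by (simp add: sum_distrib_left power_mult_distrib mult_ac)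
  qed
  also have "\<dots> = (\<Sum>j\<le>N. of_int (p j) * of_int V ^ (N - j) * (\<Sum>i\<le>N. of_nat (j choose i) * (of_int W * \<xi>) ^ i * (- of_int U) ^ (j - i)))"
  proof (intro sum.cong refl)
    fix j assume j: "j \<in> {..N}"
    have "(of_int V * F) ^ j = (of_int W * \<xi> + (- of_int U)) ^ j" by (simp add: F)
    also have "\<dots> = (\<Sum>i\<le>j. of_nat (j choose i) * (of_int W * \<xi>) ^ i * (- of_int U) ^ (j - i))"
      by (rule binomial_ring)
    also have "\<dots> = (\<Sum>i\<le>N. of_nat (j choose i) * (of_int W * \<xi>) ^ i * (- of_int U) ^ (j - i))"
      using j by (intro sum.mono_neutral_left) auto
    finally show "of_int (p j) * of_int V ^ (N - j) * (of_int V * F) ^ j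
       = of_int (p j) * of_int V ^ (N - j) * (\<Sum>i\<le>N. of_nat (j choose i) * (of_int W * \<xi>) ^ i * (- of_int U) ^ (j - i))"
      by simp
  qed
  also have "\<dots> = (\<Sum>i\<le>N. \<Sum>j\<le>N. of_int (p j) * of_int V ^ (N - j) * (of_nat (j choose i) * (of_int W * \<xi>) ^ i * (- of_int U) ^ (j - i)))"
    unfolding sum_distrib_left by (rule sum.swap)
  also have "\<dots> = (\<Sum>i\<le>N. of_int (r i) * \<xi> ^ i)"
    by (simp add: r_def sum_distrib_left sum_distrib_right power_mult_distrib mult_ac)
  finally show "of_int V ^ N * (\<Sum>j\<le>N. of_int (p j) * F ^ j) = (\<Sum>i\<le>N. of_int (r i) * \<xi> ^ i)" .
  fix i assume "i \<le> N"
  have T0: "T \<ge> 0" using bd(1) by linarith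
  have L0: "L \<ge> 0" using bd(4)[of 0] by linarith
  have "\<bar>r i\<bar> \<le> (\<Sum>j\<le>N. \<bar>p j * V ^ (N - j) * (int (j choose i) * W ^ i * (- U) ^ (j - i))\<bar>)"
    unfolding r_def by (rule sum_abs)
  also have "\<dots> \<le> (\<Sum>j\<le>N. 2 ^ N * L * T ^ N)"
  proof (rule sum_mono)
    fix j assume j: "j \<in> {..N}"
    show "\<bar>p j * V ^ (N - j) * (int (j choose i) * W ^ i * (- U) ^ (j - i))\<bar> \<le> 2 ^ N * L * T ^ N"
    proof (cases "i \<le> j")
      case False
      thus ?thesis using T0 L0 by (simp add: binomial_eq_0)
    next
      case True
      have "(j choose i) \<le> 2 ^ j" by (rule binomial_le_pow2)
      also have "(2::nat) ^ j \<le> 2 ^ N" using j by (intro power_increasing) auto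
      finally have "int (j choose i) \<le> int (2 ^ N)" by (simp only: of_nat_le_iff)
      hence ch: "int (j choose i) \<le> 2 ^ N" by simp
      have "\<bar>p j * V ^ (N - j) * (int (j choose i) * W ^ i * (- U) ^ (j - i))\<bar>
          = \<bar>p j\<bar> * \<bar>V\<bar> ^ (N - j) * (int (j choose i) * \<bar>W\<bar> ^ i * \<bar>U\<bar> ^ (j - i))"
        by (simp add: abs_mult power_abs)
      also have "\<dots> \<le> L * T ^ (N - j) * (2 ^ N * T ^ i * T ^ (j - i))"
        using bd j ch T0 L0 by (intro mult_mono power_mono mult_nonneg_nonneg zero_le_power) auto
      also have "\<dots> = 2 ^ N * L * (T ^ (N - j) * T ^ i * T ^ (j - i))" by simp
      also have "T ^ (N - j) * T ^ i * T ^ (j - i) = T ^ N"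
        using True j by (simp flip: power_add)
      finally show ?thesis .
    qed
  qed
  finally show "\<bar>r i\<bar> \<le> int (Suc N) * 2 ^ N * L * T ^ N" by (simp add: mult.assoc)
qed

text \<open>At \<open>1/t\<close> the auxiliary form becomes a nonzero integer polynomial in
  \<open>\<xi>\<close> of height about \<open>t ^ ((K + 1) N)\<close> and value at most about
  \<open>t ^ ((K + 1) N - N\<^sup>2)\<close>. The Liouville bound puts it above about
  \<open>t ^ (- \<kappa> (K + 1) N)\<close>, which is impossible once
  \<open>N > (K + 1) (\<kappa> + 1)\<close>.\<close>

lemma affine_orbit_transcendental:
  assumes b: "b \<ge> 2" and d: "d \<ge> 2" and f: "conv_unit_disc (Abs_fps c)"
    and H: "infinite {n. hankel_det c n \<noteq> 0}"
    and orbit: "affine_orbit b d (\<lambda>m. ieval (Abs_fps c) (1 / real b ^ d ^ m)) \<xi>"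
  shows "\<not> algebraic \<xi>"
proof
  assume "algebraic \<xi>"
  then obtain \<kappa> where \<kappa>: "\<And>N. \<exists>c>0. \<forall>(r :: nat \<Rightarrow> int) H. H \<ge> 1 \<longrightarrow> (\<forall>k\<le>N. \<bar>real_of_int (r k)\<bar> \<le> H) \<longrightarrow>
      (\<Sum>k\<le>N. of_int (r k) * \<xi> ^ k) \<noteq> 0 \<longrightarrow> c / H ^ \<kappa> \<le> \<bar>\<Sum>k\<le>N. of_int (r k) * \<xi> ^ k\<bar>"
    using algebraic_liouville by blast
  obtain K m0 where K: "\<And>m. m \<ge> m0 \<Longrightarrow> \<exists>U V W :: int. V \<noteq> 0 \<and> W \<noteq> 0 \<and>
     \<bar>U\<bar> \<le> (int b ^ d ^ m) ^ K \<and> \<bar>V\<bar> \<le> (int b ^ d ^ m) ^ K \<and> \<bar>W\<bar> \<le> (int b ^ d ^ m) ^ K \<and>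
     of_int V * ieval (Abs_fps c) (1 / real b ^ d ^ m) = of_int W * \<xi> - of_int U"
    using orbit unfolding affine_orbit_def by blast
  define N where "N = (K + 1) * (\<kappa> + 1) + 1"
  obtain c1 where c1: "c1 > 0" and l: "\<forall>(r :: nat \<Rightarrow> int) H. H \<ge> 1 \<longrightarrow> (\<forall>k\<le>N. \<bar>real_of_int (r k)\<bar> \<le> H) \<longrightarrow>
      (\<Sum>k\<le>N. of_int (r k) * \<xi> ^ k) \<noteq> 0 \<longrightarrow> c1 / H ^ \<kappa> \<le> \<bar>\<Sum>k\<le>N. of_int (r k) * \<xi> ^ k\<bar>"
    using \<kappa>[of N] by (elim exE conjE)
  note liouville = l[rule_format]
  obtain P where P: "\<And>j. degree (P j) \<le> N" "\<exists>j\<le>N. P j \<noteq> 0"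
    "\<And>i. i < N ^ 2 \<Longrightarrow> fps_nth (\<Sum>j\<le>N. fps_of_poly (P j) * Abs_fps c ^ j) i = 0"
  proof -
    show thesis by (rule auxiliary_form[of N "Abs_fps c"]) (rule that)
  qed
  define E where "E = (\<Sum>j\<le>N. fps_of_poly (P j) * Abs_fps c ^ j)"
  have E: "conv_unit_disc E" unfolding E_def by (intro conv_unit_disc_sum conv_unit_disc_mult conv_unit_disc_poly conv_unit_disc_power f)
  have "E \<noteq> 0" unfolding E_def by (rule hankel_imp_transcendental[OF f H P(2)])
  define h where "h = (LEAST i. fps_nth E i \<noteq> 0)"
  have "\<exists>i. fps_nth E i \<noteq> 0" using \<open>E \<noteq> 0\<close> by (simp add: fps_nonzero_nth)
  hence h: "fps_nth E h \<noteq> 0" unfolding h_def by (rule LeastI_ex)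
  have h': "fps_nth E j = 0" if "j < h" for j
    using not_less_Least[of j "\<lambda>i. fps_nth E i \<noteq> 0"] that unfolding h_def by blast
  have hN: "h \<ge> N ^ 2" using h P(3) unfolding E_def[symmetric] by (meson not_le)
  obtain c0 C0 \<delta> :: real where c0: "c0 > 0" "\<delta> > 0"
    and bounds: "\<And>z::real. 0 < z \<Longrightarrow> z < \<delta> \<Longrightarrow> c0 * z ^ h \<le> \<bar>ieval E z\<bar> \<and> \<bar>ieval E z\<bar> \<le> C0 * z ^ h"
    using ieval_leading_term[OF E h h'] by metis
  define L where "L = (\<Sum>j\<le>N. \<Sum>i\<le>degree (P j). \<bar>coeff (P j) i\<bar>) + 1"
  define G where "G = real_of_int (int (Suc N) * 2 ^ N * L)"
  have L1: "L \<ge> 1" unfolding L_def by (simp add: sum_nonneg)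
  have G1: "G \<ge> 1"
  proof -
    have "1 * 1 * 1 \<le> int (Suc N) * 2 ^ N * L" using L1 by (intro mult_mono) auto
    thus ?thesis unfolding G_def by linarith
  qed
  \<comment> \<open>The second entry is chosen to contradict the final inequality
    \<open>c1 * t \<le> \<bar>C0\<bar> * G ^ \<kappa>\<close>.\<close>
  define X where "X = max (2 / \<delta>) (\<bar>C0\<bar> * G ^ \<kappa> / c1 + 1)"
  have "eventually (\<lambda>m. X \<le> real b ^ d ^ m \<and> m \<ge> m0) sequentially"
    by (intro eventually_conj eventually_const_le_orbit[OF b d] eventually_ge_at_top)
  then obtain m where m: "X \<le> real b ^ d ^ m" "m \<ge> m0"
    unfolding eventually_sequentially by blast
  define t where "t = real b ^ d ^ m"
  define ti where "ti = int b ^ d ^ m"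
  have tt: "of_int ti = t" by (simp add: t_def ti_def)
  have tb: "2 / \<delta> \<le> t" "\<bar>C0\<bar> * G ^ \<kappa> / c1 + 1 \<le> t" using m(1) by (auto simp: t_def X_def)
  have "(2::real) ^ 1 \<le> real b ^ d ^ m" using b d
    by (intro order_trans[OF power_increasing[of 1 "d ^ m" "2::real"] power_mono]) auto
  hence t2: "t \<ge> 2" by (simp add: t_def)
  have ti1: "ti \<ge> 1" using b by (simp add: ti_def)
  define z where "z = 1 / t"
  have z: "0 < z" "z < \<delta>" "\<bar>z\<bar> < 1"
    using t2 tb(1) c0(2) by (auto simp: z_def field_simps)
  define F where "F = ieval (Abs_fps c) z"
  obtain U V W :: int where UVW: "V \<noteq> 0" "\<bar>U\<bar> \<le> ti ^ K" "\<bar>V\<bar> \<le> ti ^ K" "\<bar>W\<bar> \<le> ti ^ K"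
    "of_int V * F = of_int W * \<xi> - of_int U"
    using K[OF m(2)] unfolding ti_def[symmetric] t_def[symmetric] z_def[symmetric] F_def by blast
  have "\<exists>k::int. of_int k = t ^ N * ipoly (P j) z \<and> \<bar>k\<bar> \<le> (\<Sum>i\<le>degree (P j). \<bar>coeff (P j) i\<bar>) * ti ^ N" for j
    using ipoly_integral_multiple[OF P(1) ti1] unfolding tt z_def .
  then obtain p :: "nat \<Rightarrow> int" where p: "\<And>j. of_int (p j) = t ^ N * ipoly (P j) z"
    "\<And>j. \<bar>p j\<bar> \<le> (\<Sum>i\<le>degree (P j). \<bar>coeff (P j) i\<bar>) * ti ^ N" by metis
  have pL: "\<bar>p j\<bar> \<le> L * ti ^ N" if "j \<le> N" for j
  proof -
    have "(\<Sum>i\<le>degree (P j). \<bar>coeff (P j) i\<bar>) \<le> (\<Sum>j\<le>N. \<Sum>i\<le>degree (P j). \<bar>coeff (P j) i\<bar>)"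
      using that by (intro member_le_sum[of j "{..N}" "\<lambda>j. \<Sum>i\<le>degree (P j). \<bar>coeff (P j) i\<bar>"])
        (auto intro: sum_nonneg)
    hence "(\<Sum>i\<le>degree (P j). \<bar>coeff (P j) i\<bar>) * ti ^ N \<le> L * ti ^ N"
      unfolding L_def using ti1 by (intro mult_right_mono) auto
    thus ?thesis using p(2)[of j] by linarith
  qed
  obtain r :: "nat \<Rightarrow> int" where r: "of_int V ^ N * (\<Sum>j\<le>N. of_int (p j) * F ^ j) = (\<Sum>i\<le>N. of_int (r i) * \<xi> ^ i)"
    "\<And>i. i \<le> N \<Longrightarrow> \<bar>r i\<bar> \<le> int (Suc N) * 2 ^ N * (L * ti ^ N) * (ti ^ K) ^ N"
    using affine_power_expansion[where p = p and N = N and L = "L * ti ^ N", OF UVW(2-4) pL UVW(5)] by blast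
  have evE: "ieval E z = (\<Sum>j\<le>N. ipoly (P j) z * F ^ j)"
    unfolding E_def F_def using z(3)
    by (simp add: ieval_sum ieval_mult ieval_power conv_unit_disc_mult conv_unit_disc_poly conv_unit_disc_power f ipoly_conv_ieval)
  have R: "(\<Sum>i\<le>N. of_int (r i) * \<xi> ^ i) = of_int V ^ N * (t ^ N * ieval E z)"
    unfolding r(1)[symmetric] evE p(1) by (simp add: sum_distrib_left mult_ac)
  define Y where "Y = t ^ ((K + 1) * N)"
  have Y_eq: "Y = t ^ N * (t ^ K) ^ N" unfolding Y_def by (simp flip: power_mult power_add)
  have Y1: "Y \<ge> 1" unfolding Y_def using t2 by (intro one_le_power) auto
  have rb: "\<bar>real_of_int (r i)\<bar> \<le> G * Y" if "i \<le> N" for i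
  proof -
    have "real_of_int \<bar>r i\<bar> \<le> real_of_int (int (Suc N) * 2 ^ N * (L * ti ^ N) * (ti ^ K) ^ N)"
      using r(2)[OF that] by (simp only: of_int_le_iff)
    also have "\<dots> = real_of_int (int (Suc N) * 2 ^ N * L) * (real_of_int ti ^ N * (real_of_int ti ^ K) ^ N)"
      by simp
    also have "\<dots> = G * Y"
      unfolding tt G_def Y_eq by (rule refl)
    finally show ?thesis by simp
  qed
  \<comment> \<open>The lower bound of the leading term estimate serves as the zero estimate for the
    auxiliary form.\<close>
  have "c0 * z ^ h > 0" using c0 z by simp
  hence "\<bar>ieval E z\<bar> > 0" using bounds[OF z(1,2)] by linarith
  hence "(\<Sum>i\<le>N. of_int (r i) * \<xi> ^ i) \<noteq> 0" unfolding R using UVW(1) t2 by auto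
  hence "c1 / (G * Y) ^ \<kappa> \<le> \<bar>\<Sum>i\<le>N. of_int (r i) * \<xi> ^ i\<bar>"
    using G1 Y1 rb mult_mono[of 1 G 1 Y] by (intro liouville) auto
  also have "\<dots> = \<bar>real_of_int V\<bar> ^ N * (t ^ N * \<bar>ieval E z\<bar>)"
    unfolding R using t2 by (simp add: abs_mult power_abs)
  also have "\<dots> \<le> (t ^ K) ^ N * (t ^ N * (\<bar>C0\<bar> * z ^ (N ^ 2)))"
  proof (intro mult_mono power_mono)
    have "real_of_int \<bar>V\<bar> \<le> real_of_int (ti ^ K)" using UVW(3) by (simp only: of_int_le_iff)
    thus "\<bar>real_of_int V\<bar> \<le> t ^ K" by (simp add: tt)
    have "\<bar>ieval E z\<bar> \<le> C0 * z ^ h" using bounds[OF z(1,2)] by blast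
    also have "\<dots> \<le> \<bar>C0\<bar> * z ^ h" using z by (intro mult_right_mono) auto
    also have "\<dots> \<le> \<bar>C0\<bar> * z ^ (N ^ 2)" using z hN by (intro mult_left_mono power_decreasing) auto
    finally show "\<bar>ieval E z\<bar> \<le> \<bar>C0\<bar> * z ^ (N ^ 2)" .
  qed (use t2 in auto)
  also have "\<dots> = Y * (\<bar>C0\<bar> * z ^ (N ^ 2))"
    unfolding Y_eq by (simp only: mult_ac)
  finally have "c1 \<le> Y * (\<bar>C0\<bar> * z ^ (N ^ 2)) * (G * Y) ^ \<kappa>"
    using G1 Y1 by (simp add: pos_divide_le_eq)
  also have "\<dots> = \<bar>C0\<bar> * G ^ \<kappa> * (Y ^ (\<kappa> + 1) * z ^ (N ^ 2))"
    by (simp add: power_mult_distrib)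
  also have "\<dots> \<le> \<bar>C0\<bar> * G ^ \<kappa> * z"
  proof (intro mult_left_mono)
    \<comment> \<open>The surplus \<open>N\<close> left by the choice of \<open>N\<close> supplies
      the factor \<open>z ^ N \<le> z\<close> that beats the constants.\<close>
    have "N ^ 2 = (K + 1) * N * (\<kappa> + 1) + N"
      unfolding power2_eq_square by (subst (2) N_def) (simp add: algebra_simps)
    hence "z ^ (N ^ 2) = z ^ ((K + 1) * N * (\<kappa> + 1)) * z ^ N"
      by (simp only: power_add[of z "(K + 1) * N * (\<kappa> + 1)" N])
    moreover have "Y ^ (\<kappa> + 1) = t ^ ((K + 1) * N * (\<kappa> + 1))"
      by (simp only: Y_def power_mult[of t "(K + 1) * N" "\<kappa> + 1"])
    ultimately have "Y ^ (\<kappa> + 1) * z ^ (N ^ 2) = (t * z) ^ ((K + 1) * N * (\<kappa> + 1)) * z ^ N"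
      by (simp only: power_mult_distrib[of t z] mult.assoc)
    also have "t * z = 1" using t2 by (simp add: z_def)
    also have "1 ^ ((K + 1) * N * (\<kappa> + 1)) * z ^ N \<le> z ^ 1"
      using z power_decreasing[of 1 N z] by (simp add: N_def)
    finally show "Y ^ (\<kappa> + 1) * z ^ (N ^ 2) \<le> z" by simp
  qed (use G1 in auto)
  finally have "c1 * t \<le> \<bar>C0\<bar> * G ^ \<kappa>" using t2 by (simp add: z_def field_simps)
  moreover have "\<bar>C0\<bar> * G ^ \<kappa> + c1 \<le> c1 * t" using tb(2) c1 by (simp add: field_simps)
  ultimately show False using c1 by linarith
qed

section \<open>From large \<open>m\<close> back to \<open>m = 0\<close>\<close>

lemma rational_affine_imp_integer:
  assumes "x \<in> \<rat>" "y \<in> \<rat>" "w \<in> \<rat>" "x \<noteq> 0" "w \<noteq> (0::real)" "x * F = w * \<xi> - y"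
  obtains U V W :: int where "V \<noteq> 0" "W \<noteq> 0" "of_int V * F = of_int W * \<xi> - of_int U"
proof -
  obtain x1 x2 y1 y2 w1 w2 :: int where q: "x = of_int x1 / of_int x2" "x2 > 0"
    "y = of_int y1 / of_int y2" "y2 > 0" "w = of_int w1 / of_int w2" "w2 > 0"
    using assms(1-3) by (metis Rats_cases')
  have "of_int (x1 * y2 * w2) * F = of_int x2 * of_int y2 * of_int w2 * (x * F)"
    using q by simp
  also have "\<dots> = of_int (w1 * x2 * y2) * \<xi> - of_int (y1 * x2 * w2)"
    unfolding assms(6) using q by (simp add: algebra_simps)
  finally have "of_int (x1 * y2 * w2) * F = of_int (w1 * x2 * y2) * \<xi> - of_int (y1 * x2 * w2)" .
  moreover have "x1 * y2 * w2 \<noteq> 0" "w1 * x2 * y2 \<noteq> 0" using assms(4,5) q by auto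
  ultimately show ?thesis using that by blast
qed

theorem theorem4p2:
  fixes d b :: nat and c :: "nat \<Rightarrow> int" and A B C D :: "int poly" and n :: "nat \<Rightarrow> nat"
  assumes "d \<ge> 2"
    and "finite (range c)"
    and "B \<noteq> 0" and "D \<noteq> 0"
    and "\<forall>z::real. \<bar>z\<bar> < 1 \<longrightarrow> ipoly B z \<noteq> 0 \<longrightarrow> ipoly D z \<noteq> 0 \<longrightarrow>
           (\<Sum>j. real_of_int (c j) * z ^ j) =
             ipoly A z / ipoly B z + ipoly C z / ipoly D z * (\<Sum>j. real_of_int (c j) * (z ^ d) ^ j)"
    and "b \<ge> 2"
    and "\<forall>m::nat. ipoly C (1 / real b ^ (d ^ m)) \<noteq> 0"
    and "strict_mono n"
    and "\<forall>i. n i > 0"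
    and "\<forall>i. hankel_det c (n i) \<noteq> 0"
    and "(\<lambda>i. real (n (Suc i)) / real (n i)) \<longlonglongrightarrow> 1"
  shows "\<not> algebraic (\<Sum>j. real_of_int (c j) * (1 / real b) ^ j)
       \<and> irrationality_exponent (\<Sum>j. real_of_int (c j) * (1 / real b) ^ j) = 2"
proof -
  have "\<bar>c j\<bar> \<le> Max (abs ` range c)" for j
    using assms(2) by (intro Max_ge) auto
  hence f: "conv_unit_disc (Abs_fps c)" by (intro conv_unit_disc_bounded) simp
  have ieval: "ieval (Abs_fps c) z = (\<Sum>j. real_of_int (c j) * z ^ j)" for z by (simp add: ieval_suminf)
  have eq: "mahler_equation d (Abs_fps c) A B C D"
    using assms(5) unfolding mahler_equation_def ieval .
  define F where "F = (\<lambda>m. ieval (Abs_fps c) (1 / real b ^ d ^ m))"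
  have C: "\<And>m. ipoly C (1 / real b ^ d ^ m) \<noteq> 0" using assms(7) by blast
  obtain m0 H e where steps: "\<And>m. m \<ge> m0 \<Longrightarrow> \<exists>x y w :: int. x \<noteq> 0 \<and> w \<noteq> 0 \<and> \<bar>x\<bar> \<le> H * (int b ^ d ^ m) ^ e \<and>
        \<bar>y\<bar> \<le> H * (int b ^ d ^ m) ^ e \<and> \<bar>w\<bar> \<le> H * (int b ^ d ^ m) ^ e \<and>
        of_int x * F m = of_int y + of_int w * F (Suc m)"
  proof -
    show thesis
      by (rule mahler_integer_steps[OF f assms(6,1) eq assms(3,4) C]) (rule that, unfold F_def)
  qed
  have forms: "dense_linear_forms \<xi>" if "affine_orbit b d F \<xi>" for \<xi>
    using affine_orbit_dense_linear_forms[OF assms(6,1) f assms(8) _ assms(11)] assms(10) that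
    unfolding F_def by blast
  have large: "F m \<notin> \<rat>" if "m \<ge> m0" for m
  proof -
    \<comment> \<open>The orbit is started at \<open>m\<close> itself with the trivial relation
      \<open>1 * F m = 1 * F m - 0\<close>.\<close>
    have "affine_orbit b d F (F m)"
      by (rule affine_orbitI[OF assms(6,1), of m H e F 1 1 _ 0]) (use steps that in auto)
    thus ?thesis using forms dense_linear_forms_irrational by blast
  qed
  have rel: "\<exists>x y w. x \<in> \<rat> \<and> y \<in> \<rat> \<and> w \<in> \<rat> \<and> w \<noteq> 0 \<and> x * F m = y + w * F (Suc m)" for m
  proof -
    define a where "a = 1 / rat_of_nat (b ^ d ^ m)"
    have a: "of_rat a = 1 / real b ^ d ^ m" by (simp add: a_def of_rat_divide of_rat_power)
    have "(1::real) < 2 ^ d ^ m" using assms(1) by (intro one_less_power) auto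
    also have "(2::real) ^ d ^ m \<le> real b ^ d ^ m" using assms(6) by (intro power_mono) auto
    finally have a1: "\<bar>of_rat a :: real\<bar> < 1" unfolding a using assms(6) by (simp add: divide_less_eq_1)
    have ad: "(1 / real b ^ d ^ m) ^ d = 1 / real b ^ d ^ Suc m"
      by (simp add: power_one_over power_mult[symmetric] mult.commute)
    have Ca: "ipoly C (of_rat a) \<noteq> 0" unfolding a by (rule C)
    show ?thesis
    proof (rule mahler_equation_at_rational[OF f assms(1) eq assms(3,4) a1 Ca])
      fix x y w :: real
      assume "x \<in> \<rat>" "y \<in> \<rat>" "w \<in> \<rat>" "w \<noteq> 0"
        "x * ieval (Abs_fps c) (of_rat a) = y + w * ieval (Abs_fps c) (of_rat a ^ d)"
      thus ?thesis unfolding a ad F_def by (intro exI[of _ x] exI[of _ y] exI[of _ w] conjI)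
    qed
  qed
  \<comment> \<open>Descending induction from \<open>m0\<close>: as \<open>w \<noteq> 0\<close>, a
    rational \<open>F m\<close> would make \<open>F (Suc m)\<close> rational.\<close>
  have irr: "F m \<notin> \<rat>" if "m \<le> m0" for m
    using that
  proof (induction m rule: inc_induct)
    case (step m)
    obtain x y w where xyw: "x \<in> \<rat>" "y \<in> \<rat>" "w \<in> \<rat>" "w \<noteq> 0" "x * F m = y + w * F (Suc m)"
      using rel by blast
    show ?case
    proof
      assume "F m \<in> \<rat>"
      hence "(x * F m - y) / w \<in> \<rat>" using xyw by (intro Rats_divide Rats_diff Rats_mult)
      moreover have "(x * F m - y) / w = F (Suc m)" using xyw by (simp add: field_simps)
      ultimately show False using step.IH by simp
    qed
  qed (use large in auto)
  have irr': "F m \<notin> \<rat>" for m using irr large by (cases "m \<le> m0") auto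
  have "\<exists>x y w. x \<in> \<rat> \<and> y \<in> \<rat> \<and> w \<in> \<rat> \<and> x \<noteq> 0 \<and> w \<noteq> 0 \<and> x * F m = w * F 0 - y" for m
  proof (induction m)
    case 0
    show ?case by (intro exI[of _ 1] exI[of _ 0]) auto
  next
    case (Suc m)
    then obtain x y w where IH: "x \<in> \<rat>" "y \<in> \<rat>" "w \<in> \<rat>" "x \<noteq> 0" "w \<noteq> 0" "x * F m = w * F 0 - y" by blast
    obtain x' y' w' where st: "x' \<in> \<rat>" "y' \<in> \<rat>" "w' \<in> \<rat>" "w' \<noteq> 0" "x' * F m = y' + w' * F (Suc m)"
      using rel[of m] by blast
    \<comment> \<open>A zero of \<open>D\<close> at the orbit point could make \<open>x'\<close>
      vanish, but then \<open>F (Suc m)\<close> would be rational.\<close>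
    have "x' \<noteq> 0"
    proof
      assume "x' = 0"
      hence "F (Suc m) = - y' / w'" using st(4,5) by (simp add: field_simps)
      thus False using irr'[of "Suc m"] st(2,3) by simp
    qed
    have "x * w' * F (Suc m) = x * (x' * F m - y')" using st(5) by simp
    also have "\<dots> = x' * (x * F m) - x * y'" by (simp add: algebra_simps)
    also have "\<dots> = x' * w * F 0 - (x' * y + x * y')" unfolding IH(6) by (simp add: algebra_simps)
    finally have "x * w' * F (Suc m) = x' * w * F 0 - (x' * y + x * y')" .
    thus ?case using IH st \<open>x' \<noteq> 0\<close>
      by (intro exI[of _ "x * w'"] exI[of _ "x' * y + x * y'"] exI[of _ "x' * w"]) auto
  qed
  then obtain x y w where "x \<in> \<rat>" "y \<in> \<rat>" "w \<in> \<rat>" "x \<noteq> 0" "w \<noteq> 0" "x * F m0 = w * F 0 - y" by blast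
  then obtain U V W :: int where "V \<noteq> 0" "W \<noteq> 0" "of_int V * F m0 = of_int W * F 0 - of_int U"
    by (rule rational_affine_imp_integer)
  hence orbit: "affine_orbit b d F (F 0)"
    using affine_orbitI[OF assms(6,1), of m0 H e F V W "F 0" U] steps by blast
  have "infinite (range n)" using assms(8) strict_mono_imp_inj_on finite_imageD infinite_UNIV_nat by blast
  hence "infinite {k. hankel_det c k \<noteq> 0}"
    by (rule infinite_super[rotated]) (use assms(10) in auto)
  hence "\<not> algebraic (F 0)"
    using affine_orbit_transcendental[OF assms(6,1) f] orbit unfolding F_def by blast
  moreover have "irrationality_exponent (F 0) = 2"
    using irrationality_exponent_ge_2[OF irr'] dense_linear_forms_exponent_le_2[OF forms[OF orbit]] by (rule antisym[rotated])
  moreover have "F 0 = (\<Sum>j. real_of_int (c j) * (1 / real b) ^ j)" by (simp add: F_def ieval)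
  ultimately show ?thesis by simp
qed

end
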